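(* Let $(G_n)_n$ be a sequence of finite simple graphs which is convergent in the dense model, i.e. for every fixed finite simple graph $F$ the sequence $\hom(F,G_n)/v(G_n)^{v(F)}$ converges. Let $f:B\to\mathbb{C}$ be a holomorphic function on the open disk $B=B(0,8)=\{z\in\mathbb{C}:|z|<8\}$. Then the sequence $$\int f(z)\,\mathrm{d}\nu_{G_n}(z)$$ converges, where $\nu_{G}$ denotes the rescaled chromatic measure defined below.
   Context: For a finite simple graph $G$, $v(G)$ is its number of vertices and $\hom(F,G)$ is the number of graph homomorphisms from $F$ to $G$. The chromatic polynomial of a graph $G$ on $n$ vertices is $P(G,x)=\sum_{k=0}^n \mathrm{ip}(G,k)\,x(x-1)\cdots(x-k+1)$, where $\mathrm{ip}(G,k)$ is the number of partitions of $V(G)$ into $k$ nonempty independent sets; it is a polynomial of degree $n$ in the complex variable $x$. The chromatic measure $\mu_G$ is the uniform probability measure on the multiset of the $n$ roots (with multiplicity) of $P(G,x)$. The rescaled chromatic measure is $\nu_G(X):=\mu_G(nX)$ for $X\subseteq\mathbb{C}$, where $n=v(G)$ and $nX=\{nx:x\in X\}$; i.e. $\nu_G$ is the uniform measure on the roots of $P(G,x)$ divided by $n$. (By Sokal's bound, every chromatic root of a graph of maximum degree $D$ has modulus strictly less than $8D$, so $\nu_G$ is supported in $B(0,8)$ and the integral is well defined.)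
   Formalization: The formal theorem additionally assumes v(G_n) → ∞; without it the claim fails, e.g. alternating K_2 and C_4 have equal homomorphism densities, but for f(z)=z² the integrals are 1/8 and 1/16. *)

theory Defs
  imports
    "HOL-Probability.Probability"
    "HOL-Complex_Analysis.Complex_Analysis"
    "HOL-Computational_Algebra.Computational_Algebra"
    "Graph_Theory.Pair_Digraph"
begin

text \<open>
  A finite simple graph is a \<^const>\<open>pair_graph\<close>: a finite vertex set together with a symmetric,
  loop-free set of arcs, where an edge \<open>uv\<close> is represented by the two arcs \<open>(u, v)\<close> and \<open>(v, u)\<close>.
\<close>

definition num_verts :: "'a pair_pre_digraph \<Rightarrow> nat" where
  "num_verts G = card (pverts G)"

text \<open>Homomorphisms are extensional functions on the vertex set, so that each is counted once.\<close>

definition graph_homs :: "'b pair_pre_digraph \<Rightarrow> 'a pair_pre_digraph \<Rightarrow> ('b \<Rightarrow> 'a) set" where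
  "graph_homs F G =
     {\<phi> \<in> pverts F \<rightarrow>\<^sub>E pverts G. \<forall>u v. (u, v) \<in> parcs F \<longrightarrow> (\<phi> u, \<phi> v) \<in> parcs G}"

definition hom_count :: "'b pair_pre_digraph \<Rightarrow> 'a pair_pre_digraph \<Rightarrow> nat" where
  "hom_count F G = card (graph_homs F G)"

text \<open>
  The test graphs \<open>F\<close> have natural numbers as vertices; up to isomorphism these are all finite
  simple graphs. The densities alone do not force \<open>v(G\<^sub>n) \<rightarrow> \<infinity>\<close>: a graph and its balanced blow-ups have
  equal densities, but in general different rescaled chromatic measures (e.g. \<open>K\<^sub>2\<close> and \<open>C\<^sub>4\<close>). Hence
  growth of the vertex sets, customary for dense graph limits, is always assumed separately.
\<close>

definition dense_convergent :: "(nat \<Rightarrow> 'a pair_pre_digraph) \<Rightarrow> bool" where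
  "dense_convergent G \<longleftrightarrow>
     (\<forall>F :: nat pair_pre_digraph. pair_graph F \<longrightarrow>
        convergent (\<lambda>n. real (hom_count F (G n)) / real (num_verts (G n)) ^ num_verts F))"

definition indep_set :: "'a pair_pre_digraph \<Rightarrow> 'a set \<Rightarrow> bool" where
  "indep_set G A \<longleftrightarrow> A \<subseteq> pverts G \<and> (\<forall>u\<in>A. \<forall>v\<in>A. (u, v) \<notin> parcs G)"

definition indep_partitions :: "'a pair_pre_digraph \<Rightarrow> nat \<Rightarrow> 'a set set set" where
  "indep_partitions G k =
     {P. partition_on (pverts G) P \<and> card P = k \<and> (\<forall>A\<in>P. indep_set G A)}"

definition ip :: "'a pair_pre_digraph \<Rightarrow> nat \<Rightarrow> nat" where
  "ip G k = card (indep_partitions G k)"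

definition falling_poly :: "nat \<Rightarrow> complex poly" where
  "falling_poly k = (\<Prod>i<k. [:- of_nat i, 1:])"

definition chromatic_poly :: "'a pair_pre_digraph \<Rightarrow> complex poly" where
  "chromatic_poly G = (\<Sum>k\<le>num_verts G. smult (of_nat (ip G k)) (falling_poly k))"

text \<open>Unspecified for the graph without vertices, whose chromatic polynomial has no roots.\<close>

definition chromatic_measure :: "'a pair_pre_digraph \<Rightarrow> complex pmf" where
  "chromatic_measure G = pmf_of_multiset (proots (chromatic_poly G))"

definition rescaled_chromatic_measure :: "'a pair_pre_digraph \<Rightarrow> complex pmf" where
  "rescaled_chromatic_measure G =
     map_pmf (\<lambda>z. z / of_nat (num_verts G)) (chromatic_measure G)"

lemma measure_rescaled_chromatic_measure:
  assumes "num_verts G > 0"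
  shows "measure_pmf.prob (rescaled_chromatic_measure G) X =
         measure_pmf.prob (chromatic_measure G) ((\<lambda>z. of_nat (num_verts G) * z) ` X)"
proof -
  have "(\<lambda>z. z / of_nat (num_verts G)) -` X = (\<lambda>z :: complex. of_nat (num_verts G) * z) ` X"
    using assms by (force simp: image_iff)
  then show ?thesis
    by (simp add: rescaled_chromatic_measure_def)
qed

end

theory Submission
  imports Defs
begin

text \<open>
  Write \<open>P(V, E)\<close> for the chromatic polynomial of the graph induced by \<open>E\<close> on \<open>V\<close>. Colouring a vertex
  \<open>u\<close> last gives \<open>P(V + u, E) = x P(V, E) - (\<Sum>v\<in>N(u) \<inter> V. P(V, E\<^sub>v))\<close>, where \<open>E\<^sub>v\<close> joins \<open>v\<close> to the
  neighbours of \<open>u\<close> that follow \<open>v\<close> in a fixed order of the vertices; note that \<open>E\<close> and \<open>E\<^sub>v\<close> agree on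
  \<open>V - v\<close>. This recursion is used twice.

  First, for \<open>|x| \<ge> 6 |V|\<close> it shows inductively that \<open>P(V + u, E)\<close> differs from \<open>x P(V, E)\<close> by at most
  half of the latter, so all roots of \<open>P(V, E)\<close> have modulus at most \<open>6 |V|\<close>. After rescaling they lie in
  a compact subset of the disk of radius 8, and by Tannery's theorem it is enough to prove convergence
  of the moments \<open>p\<^sub>k(G) / n\<^bsup>k+1\<^esup>\<close>, where \<open>p\<^sub>k\<close> is the \<open>k\<close>-th power sum of the roots.

  Secondly, for the reversed polynomials \<open>Z(V) = t\<^bsup>|V|\<^esup> P(V, 1/t)\<close> it expresses \<open>Z(V + u) / Z(V)\<close> through
  quotients of the same kind for smaller sets, multiplied by \<open>t\<close>. Hence the \<open>t\<^sup>k\<close>-coefficient of this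
  quotient, as a function of \<open>V\<close>, is a sum of contributions of subsets of size at most \<open>k\<close>. Taking
  logarithmic derivatives, \<open>p\<^sub>k(G)\<close> becomes a sum over the induced subgraphs on at most \<open>k + 1\<close> vertices
  of an isomorphism invariant. The subgraphs with fewer vertices contribute \<open>O(n\<^sup>k)\<close>, and the sum over those
  with exactly \<open>k + 1\<close> vertices is, up to \<open>O(n\<^sup>k)\<close>, a fixed linear combination of homomorphism numbers.
\<close>

unbundle no vec_syntax

section \<open>Independent partitions and the vertex recursion\<close>

text \<open>Vertex set and relation are separate arguments: shrinking \<open>V\<close> passes to
  induced subgraphs with \<open>E\<close> unchanged. As independence tests both ordered pairs, an
  edge may be given in one direction only, as \<open>star\<close> does below.\<close>

definition ind_partitions :: "'a set \<Rightarrow> ('a \<times> 'a) set \<Rightarrow> 'a set set set" where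
  "ind_partitions V E = {P. partition_on V P \<and> (\<forall>A\<in>P. \<forall>u\<in>A. \<forall>v\<in>A. (u, v) \<notin> E)}"

definition cpoly :: "'a set \<Rightarrow> ('a \<times> 'a) set \<Rightarrow> complex poly" where
  "cpoly V E = (\<Sum>P\<in>ind_partitions V E. falling_poly (card P))"

lemma finite_ind_partitions: "finite V \<Longrightarrow> finite (ind_partitions V E)"
  unfolding ind_partitions_def by (rule finite_subset[OF _ finitely_many_partition_on[of V]]) auto

lemma partition_on_block_unique:
  assumes "partition_on V Q" "B \<in> Q" "C \<in> Q" "x \<in> B" "x \<in> C"
  shows "B = C"
  using assms by (metis disjoint_def disjoint_iff partition_onD2)

lemma card_partition_on_le:
  assumes "finite V" "partition_on V P"
  shows "card P \<le> card V"
proof -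
  have "\<forall>A\<in>P. \<exists>x. x \<in> A" using partition_onD3[OF assms(2)] by (metis ex_in_conv)
  then obtain s where s: "\<And>A. A \<in> P \<Longrightarrow> s A \<in> A" by metis
  have "inj_on s P"
    using s by (intro inj_onI) (metis partition_on_block_unique[OF assms(2)])
  moreover have "s ` P \<subseteq> V" using s partition_onD1[OF assms(2)] by auto
  ultimately show ?thesis using assms(1) card_inj_on_le by blast
qed

text \<open>Partitions are grouped by their number of blocks, which never exceeds the number of
  vertices.\<close>

lemma chromatic_poly_eq_cpoly:
  assumes "finite (pverts G)"
  shows "chromatic_poly G = cpoly (pverts G) (parcs G)"
proof -
  have eq: "indep_partitions G k = {P \<in> ind_partitions (pverts G) (parcs G). card P = k}" for k
    unfolding indep_partitions_def ind_partitions_def indep_set_def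
    by (auto dest: partition_onD1)
  have "cpoly (pverts G) (parcs G) =
     (\<Sum>k\<le>num_verts G. \<Sum>P\<in>{P \<in> ind_partitions (pverts G) (parcs G). card P = k}. falling_poly (card P))"
    unfolding cpoly_def
    by (rule sum.group[symmetric])
       (use assms in \<open>auto simp: finite_ind_partitions num_verts_def,
         auto simp: ind_partitions_def intro: card_partition_on_le\<close>)
  also have "\<dots> = chromatic_poly G"
    unfolding chromatic_poly_def ip_def eq by (intro sum.cong) (auto simp: of_nat_poly)
  finally show ?thesis ..
qed

text \<open>In terms of colourings: a further block takes any of the \<open>x\<close> colours except
  the \<open>k\<close> in use.\<close>

lemma falling_poly_Suc: "falling_poly (Suc k) = [:0, 1:] * falling_poly k - of_nat k * falling_poly k"
proof -
  have "falling_poly (Suc k) = falling_poly k * [:- of_nat k, 1:]"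
    by (simp add: falling_poly_def)
  also have "[:- of_nat k, 1:] = [:0, 1:] - (of_nat k :: complex poly)"
    by (simp add: of_nat_poly)
  finally show ?thesis by (simp add: algebra_simps)
qed

definition nbrs :: "('a \<times> 'a) set \<Rightarrow> 'a \<Rightarrow> 'a set" where
  "nbrs E u = {w. (u, w) \<in> E \<or> (w, u) \<in> E}"

lemma nbrs_iff: "w \<in> nbrs E u \<longleftrightarrow> (u, w) \<in> E \<or> (w, u) \<in> E"
  by (simp add: nbrs_def)

text \<open>Blocks are tested on both orders of a pair, so only the symmetric closure of the
  relation on \<open>V\<close> matters.\<close>

lemma ind_partitions_cong:
  assumes "\<And>u v. u \<in> V \<Longrightarrow> v \<in> V \<Longrightarrow> v \<in> nbrs E u \<longleftrightarrow> v \<in> nbrs E' u"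
  shows "ind_partitions V E = ind_partitions V E'"
proof -
  have "(\<forall>A\<in>P. \<forall>u\<in>A. \<forall>v\<in>A. (u, v) \<notin> E) \<longleftrightarrow> (\<forall>A\<in>P. \<forall>u\<in>A. \<forall>v\<in>A. (u, v) \<notin> E')"
    if "partition_on V P" for P
  proof -
    have "A \<subseteq> V" if "A \<in> P" for A using \<open>partition_on V P\<close> that partition_onD1 by blast
    then have "(\<forall>A\<in>P. \<forall>u\<in>A. \<forall>v\<in>A. (u, v) \<notin> X) \<longleftrightarrow> (\<forall>A\<in>P. \<forall>u\<in>A. \<forall>v\<in>A. v \<notin> nbrs X u)" for X
      by (auto simp: nbrs_iff)
    moreover have "(\<forall>A\<in>P. \<forall>u\<in>A. \<forall>v\<in>A. v \<notin> nbrs E u) \<longleftrightarrow> (\<forall>A\<in>P. \<forall>u\<in>A. \<forall>v\<in>A. v \<notin> nbrs E' u)"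
      using assms \<open>\<And>A. A \<in> P \<Longrightarrow> A \<subseteq> V\<close> by (meson subsetD)
    ultimately show ?thesis by simp
  qed
  then show ?thesis unfolding ind_partitions_def by (intro Collect_cong conj_cong refl)
qed

lemma cpoly_cong:
  assumes "\<And>u v. u \<in> V \<Longrightarrow> v \<in> V \<Longrightarrow> v \<in> nbrs E u \<longleftrightarrow> v \<in> nbrs E' u"
  shows "cpoly V E = cpoly V E'"
  using ind_partitions_cong[of V E E'] assms by (simp add: cpoly_def)

lemma cpoly_empty [simp]: "cpoly {} E = 1"
proof -
  have "ind_partitions {} E = {{}}" by (auto simp: ind_partitions_def partition_on_empty)
  then show ?thesis by (simp add: cpoly_def falling_poly_def)
qed

text \<open>Deleting \<open>u\<close> from an independent partition leaves one of the rest; going back, \<open>u\<close> either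
  forms a block of its own or joins a block free of neighbours.\<close>

lemma sum_ind_partitions_insert:
  fixes F :: "nat \<Rightarrow> 'b :: comm_ring_1"
  assumes V: "finite V" "u \<notin> V" and irr: "(u, u) \<notin> E"
  shows "(\<Sum>P\<in>ind_partitions (insert u V) E. F (card P)) =
    (\<Sum>Q\<in>ind_partitions V E. F (Suc (card Q)) + of_nat (card {B\<in>Q. B \<inter> nbrs E u = {}}) * F (card Q))"
proof -
  let ?I = "ind_partitions (insert u V) E" and ?J = "ind_partitions V E"
  have fin: "finite P" if "P \<in> ?I" for P
    using that V finite_elements[of "insert u V"] by (auto simp: ind_partitions_def)
  have finJ: "finite Q" if "Q \<in> ?J" for Q
    using that V finite_elements[of "V"] by (auto simp: ind_partitions_def)
  have notin: "u \<notin> B" if "Q \<in> ?J" "B \<in> Q" for Q B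
    using that V by (auto simp: ind_partitions_def dest: partition_onD1)
  have alone: "(\<Sum>P\<in>{P\<in>?I. {u} \<in> P}. F (card P)) = (\<Sum>Q\<in>?J. F (Suc (card Q)))"
  proof (rule sum.reindex_bij_witness[of _ "insert {u}" "\<lambda>P. P - {{u}}"])
    fix P assume P: "P \<in> {P\<in>?I. {u} \<in> P}"
    show "insert {u} (P - {{u}}) = P" using P by auto
    have *: "P = insert {u} (P - {{u}})" using P by auto
    have "disjnt {u} (\<Union>(P - {{u}}))"
      using P by (fastforce simp: ind_partitions_def partition_on_def disjoint_def disjnt_def)
    then have "partition_on (insert u V - {u}) (P - {{u}})"
      using P * partition_on_insert[of "{u}" "P - {{u}}" "insert u V"]
      by (simp add: ind_partitions_def)
    then show "P - {{u}} \<in> ?J" using P V by (auto simp: ind_partitions_def)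
    show "F (Suc (card (P - {{u}}))) = F (card P)"
      using fin P by (metis (no_types, lifting) card.remove mem_Collect_eq)
  next
    fix Q assume Q: "Q \<in> ?J"
    then have "{u} \<notin> Q" using notin by blast
    then show "insert {u} Q - {{u}} = Q" by auto
    have "disjnt {u} (\<Union>Q)" using notin[OF Q] by (auto simp: disjnt_def)
    then have "partition_on (insert u V) (insert {u} Q)"
      using partition_on_insert[of "{u}" Q "insert u V"] Q V by (simp add: ind_partitions_def)
    then show "insert {u} Q \<in> {P\<in>?I. {u} \<in> P}"
      using Q irr by (auto simp: ind_partitions_def)
  qed
  define blk where "blk P = (THE A. A \<in> P \<and> u \<in> A)" for P
  have blkI: "blk P = A" if "P \<in> ?I" "A \<in> P" "u \<in> A" for P A
  proof -
    have p: "partition_on (insert u V) P" using that by (simp add: ind_partitions_def)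
    show ?thesis
      unfolding blk_def
    proof (rule the_equality)
      show "A \<in> P \<and> u \<in> A" using that by simp
      show "B = A" if "B \<in> P \<and> u \<in> B" for B
        using that \<open>A \<in> P\<close> \<open>u \<in> A\<close> partition_on_block_unique[OF p, of B A u] by simp
    qed
  qed
  have blk: "blk P \<in> P" "u \<in> blk P" if P: "P \<in> ?I" for P
  proof -
    have "u \<in> \<Union>P" using P by (auto simp: ind_partitions_def partition_on_def)
    then obtain A where "A \<in> P" "u \<in> A" by blast
    then show "blk P \<in> P" "u \<in> blk P" using blkI[OF P] by auto
  qed
  \<comment> \<open>A partition in which \<open>u\<close> is not alone corresponds to the partition
    left after deleting \<open>u\<close>, paired with the block that contained
    \<open>u\<close>.\<close>
  have joined: "(\<Sum>P\<in>{P\<in>?I. {u} \<notin> P}. F (card P)) =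
      (\<Sum>(Q, B)\<in>Sigma ?J (\<lambda>Q. {B\<in>Q. B \<inter> nbrs E u = {}}). F (card Q))"
  proof (rule sum.reindex_bij_witness[of _ "\<lambda>(Q, B). insert (insert u B) (Q - {B})"
        "\<lambda>P. (insert (blk P - {u}) (P - {blk P}), blk P - {u})"])
    fix P assume "P \<in> {P\<in>?I. {u} \<notin> P}"
    then have P: "P \<in> ?I" and nu: "{u} \<notin> P" by auto
    define A where "A = blk P"
    have A: "A \<in> P" "u \<in> A" using blk[OF P] by (auto simp: A_def)
    have p: "partition_on (insert u V) P" and i: "\<forall>A\<in>P. \<forall>u\<in>A. \<forall>v\<in>A. (u, v) \<notin> E"
      using P by (auto simp: ind_partitions_def)
    have disj: "disjnt A B" if "B \<in> P - {A}" for B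
      using that A partition_on_block_unique[OF p] by (auto simp: disjnt_def)
    have ne: "A - {u} \<noteq> {}" using nu A by (metis Diff_eq_empty_iff insert_absorb subset_singletonD empty_iff)
    \<comment> \<open>The shrunk block is nonempty and disjoint from the other blocks, hence none of
      them; so deleting \<open>u\<close> preserves the number of blocks.\<close>
    have new: "A - {u} \<notin> P - {A}" using disj[of "A - {u}"] ne by (auto simp: disjnt_def)
    have eq: "insert u (A - {u}) = A" using A by auto
    show "(case (insert (blk P - {u}) (P - {blk P}), blk P - {u}) of
          (Q, B) \<Rightarrow> insert (insert u B) (Q - {B})) = P"
      using A new eq unfolding A_def[symmetric] by auto
    have "P = insert A (P - {A})" using A by auto
    moreover have "disjnt A (\<Union>(P - {A}))" using disj by (auto simp: disjnt_def)
    ultimately have *: "partition_on (insert u V - A) (P - {A})" "A \<subseteq> insert u V"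
      using partition_on_insert[of A "P - {A}" "insert u V"] p by auto
    have "disjnt (A - {u}) (\<Union>(P - {A}))" using disj by (auto simp: disjnt_def)
    moreover have "V - (A - {u}) = insert u V - A" using A V by auto
    ultimately have "partition_on V (insert (A - {u}) (P - {A}))"
      using partition_on_insert[of "A - {u}" "P - {A}" V] * ne by auto
    then have "insert (A - {u}) (P - {A}) \<in> ?J" using i A by (auto simp: ind_partitions_def)
    moreover have "(A - {u}) \<inter> nbrs E u = {}" using i A by (auto simp: nbrs_iff)
    ultimately show "(insert (blk P - {u}) (P - {blk P}), blk P - {u})
        \<in> Sigma ?J (\<lambda>Q. {B\<in>Q. B \<inter> nbrs E u = {}})"
      unfolding A_def[symmetric] by auto
    have "card (insert (A - {u}) (P - {A})) = card P"
      using new A fin[OF P] by (metis card_insert_disjoint finite_Diff insert_Diff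
          insert_Diff_single card_Suc_Diff1)
    then show "(case (insert (blk P - {u}) (P - {blk P}), blk P - {u}) of (Q, B) \<Rightarrow> F (card Q)) = F (card P)"
      unfolding A_def[symmetric] by simp
  next
    fix QB assume "QB \<in> Sigma ?J (\<lambda>Q. {B\<in>Q. B \<inter> nbrs E u = {}})"
    then obtain Q B where QB: "QB = (Q, B)" and Q: "Q \<in> ?J" and B: "B \<in> Q" "B \<inter> nbrs E u = {}"
      by auto
    let ?P = "insert (insert u B) (Q - {B})"
    have p: "partition_on V Q" and i: "\<forall>A\<in>Q. \<forall>u\<in>A. \<forall>v\<in>A. (u, v) \<notin> E"
      using Q by (auto simp: ind_partitions_def)
    have uB: "u \<notin> B" using notin Q B by auto
    have disj: "disjnt B C" if "C \<in> Q - {B}" for C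
      using that B partition_on_block_unique[OF p] by (auto simp: disjnt_def)
    have "Q = insert B (Q - {B})" using B by auto
    moreover have "disjnt B (\<Union>(Q - {B}))" using disj by (auto simp: disjnt_def)
    ultimately have *: "partition_on (V - B) (Q - {B})" "B \<subseteq> V"
      using partition_on_insert[of B "Q - {B}" V] p by auto
    have "disjnt (insert u B) (\<Union>(Q - {B}))" using disj notin[OF Q] by (auto simp: disjnt_def)
    moreover have "insert u V - insert u B = V - B" using V by auto
    ultimately have "partition_on (insert u V) ?P"
      using partition_on_insert[of "insert u B" "Q - {B}" "insert u V"] * by auto
    moreover have "\<forall>A\<in>?P. \<forall>u\<in>A. \<forall>v\<in>A. (u, v) \<notin> E"
      using i B irr by (auto simp: nbrs_iff)
    ultimately have P: "?P \<in> ?I" by (auto simp: ind_partitions_def)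
    have "{u} \<notin> ?P"
    proof -
      obtain x where "x \<in> B" using B partition_onD3[OF p] by (metis ex_in_conv)
      then have "{u} \<noteq> insert u B" using uB by (metis insertCI singletonD)
      then show ?thesis using notin[OF Q] by blast
    qed
    then show "(case QB of (Q, B) \<Rightarrow> insert (insert u B) (Q - {B})) \<in> {P\<in>?I. {u} \<notin> P}"
      using P QB by auto
    have b: "blk ?P = insert u B" using blkI[OF P] by auto
    have "insert u B \<notin> Q" using notin[OF Q] by auto
    then have "?P - {insert u B} = Q - {B}" by auto
    then show "(insert (blk (case QB of (Q, B) \<Rightarrow> insert (insert u B) (Q - {B})) - {u})
          ((case QB of (Q, B) \<Rightarrow> insert (insert u B) (Q - {B})) -
           {blk (case QB of (Q, B) \<Rightarrow> insert (insert u B) (Q - {B}))}),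
         blk (case QB of (Q, B) \<Rightarrow> insert (insert u B) (Q - {B})) - {u}) = QB"
      using QB b uB B by (simp add: insert_absorb)
  qed
  have "(\<Sum>P\<in>?I. F (card P)) = (\<Sum>P\<in>{P\<in>?I. {u} \<in> P}. F (card P)) + (\<Sum>P\<in>{P\<in>?I. {u} \<notin> P}. F (card P))"
    by (subst sum.union_disjoint[symmetric])
       (use V in \<open>auto simp: finite_ind_partitions intro!: sum.cong\<close>)
  also have "\<dots> = (\<Sum>Q\<in>?J. F (Suc (card Q))) + (\<Sum>Q\<in>?J. \<Sum>B\<in>{B\<in>Q. B \<inter> nbrs E u = {}}. F (card Q))"
    unfolding alone joined using V finJ by (subst sum.Sigma) (auto simp: finite_ind_partitions)
  finally show ?thesis by (simp add: sum.distrib)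
qed

text \<open>The relation \<open>E\<^sub>v\<close> of the recursion; \<open>h\<close> encodes the order of the vertices.\<close>

definition star :: "('a \<Rightarrow> nat) \<Rightarrow> ('a \<times> 'a) set \<Rightarrow> 'a \<Rightarrow> 'a \<Rightarrow> ('a \<times> 'a) set" where
  "star h E u v = E \<union> {(v, w) | w. w \<in> nbrs E u \<and> h v < h w}"

text \<open>Each block meeting \<open>N\<close> is represented by its element of \<open>N\<close>
  with the largest \<open>h\<close>-value; the right-hand set consists of these
  representatives.\<close>

lemma card_blocks_meeting:
  assumes p: "partition_on V Q" and V: "finite V" and h: "inj_on h V"
  shows "card {B\<in>Q. B \<inter> N \<noteq> {}} =
    card {v \<in> N \<inter> V. \<forall>B\<in>Q. v \<in> B \<longrightarrow> (\<forall>w\<in>B \<inter> N. \<not> h v < (h w :: nat))}" (is "card ?L = card ?R")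
proof -
  have fB: "finite B" "B \<subseteq> V" if "B \<in> Q" for B
    using p V that by (auto dest: partition_onD1 intro: finite_subset)
  have "\<exists>m\<in>B \<inter> N. \<forall>w\<in>B \<inter> N. h w \<le> h m" if "B \<in> ?L" for B
  proof -
    have "Max (h ` (B \<inter> N)) \<in> h ` (B \<inter> N)" using that fB[of B] by (intro Max_in) auto
    then obtain m where "m \<in> B \<inter> N" "h m = Max (h ` (B \<inter> N))" by auto
    moreover have "\<forall>w\<in>B \<inter> N. h w \<le> Max (h ` (B \<inter> N))" using that fB[of B] by auto
    ultimately show ?thesis by metis
  qed
  then obtain last where last: "\<And>B. B \<in> ?L \<Longrightarrow> last B \<in> B \<inter> N \<and> (\<forall>w\<in>B \<inter> N. h w \<le> h (last B))"
    by metis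
  have "bij_betw last ?L ?R"
  proof (rule bij_betwI')
    fix B C assume BC: "B \<in> ?L" "C \<in> ?L"
    show "last B = last C \<longleftrightarrow> B = C"
      using last[OF BC(1)] last[OF BC(2)] BC partition_on_block_unique[OF p, of B C "last C"] by auto
  next
    fix B assume B: "B \<in> ?L"
    have "C = B" if "C \<in> Q" "last B \<in> C" for C
      using last[OF B] that B partition_on_block_unique[OF p, of C B] by auto
    then show "last B \<in> ?R" using last[OF B] fB[of B] B by (auto simp: not_less)
  next
    fix v assume v: "v \<in> ?R"
    then obtain B where B: "B \<in> Q" "v \<in> B" using p by (auto simp: partition_on_def)
    then have BL: "B \<in> ?L" using v by auto
    have "\<not> h v < h (last B)" using v B last[OF BL] by blast
    moreover have "h v \<le> h (last B)" using v B last[OF BL] by blast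
    ultimately have "h v = h (last B)" by simp
    then have "v = last B" using h v last[OF BL] fB[OF B(1)] by (auto simp: inj_on_def)
    then show "\<exists>B\<in>?L. v = last B" using BL by auto
  qed
  then show ?thesis by (rule bij_betw_same_card)
qed

text \<open>The added pairs keep \<open>v\<close> out of any block with a later neighbour of
  \<open>u\<close>. For \<open>v\<close> in \<open>nbrs E u\<close> this makes \<open>v\<close> the
  last neighbour of \<open>u\<close> in its block.\<close>

lemma ind_partitions_star:
  assumes "v \<in> V"
  shows "ind_partitions V (star h E u v) =
    {Q \<in> ind_partitions V E. \<forall>B\<in>Q. v \<in> B \<longrightarrow> (\<forall>w\<in>B \<inter> nbrs E u. \<not> h v < h w)}"
  unfolding ind_partitions_def star_def by auto

text \<open>If \<open>u\<close> could join any block, the result would be \<open>x P(V, E)\<close>.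
  To be subtracted are the choices of a block meeting \<open>nbrs E u\<close>. Counting such blocks
  by their last neighbour of \<open>u\<close> and exchanging the sums, each neighbour
  \<open>v\<close> contributes the partitions in which it is the last one of its block.\<close>

lemma cpoly_insert:
  assumes V: "finite V" "u \<notin> V" and irr: "(u, u) \<notin> E" and h: "inj_on h V"
  shows "cpoly (insert u V) E = [:0, 1:] * cpoly V E - (\<Sum>v\<in>nbrs E u \<inter> V. cpoly V (star h E u v))"
proof -
  let ?J = "ind_partitions V E" and ?N = "nbrs E u"
  let ?c = "\<lambda>v Q. \<forall>B\<in>Q. v \<in> B \<longrightarrow> (\<forall>w\<in>B \<inter> ?N. \<not> h v < h w)"
  define F where "F = falling_poly"
  have step: "F (Suc (card Q)) + of_nat (card {B\<in>Q. B \<inter> ?N = {}}) * F (card Q) =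
     [:0, 1:] * F (card Q) - (\<Sum>v\<in>?N \<inter> V. if ?c v Q then F (card Q) else 0)"
    if Q: "Q \<in> ?J" for Q
  proof -
    have p: "partition_on V Q" using Q by (simp add: ind_partitions_def)
    have "card Q = card {B\<in>Q. B \<inter> ?N = {}} + card {B\<in>Q. B \<inter> ?N \<noteq> {}}"
    proof -
      have "{B\<in>Q. B \<inter> ?N \<noteq> {}} = Q - {B\<in>Q. B \<inter> ?N = {}}" by blast
      then show ?thesis
        using card_Diff_subset[of "{B\<in>Q. B \<inter> ?N = {}}" Q] finite_elements[OF V(1) p]
          card_mono[of Q "{B\<in>Q. B \<inter> ?N = {}}"] by simp
    qed
    then have "card Q = card {B\<in>Q. B \<inter> ?N = {}} + card {v\<in>?N \<inter> V. ?c v Q}"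
      by (simp only: card_blocks_meeting[OF p V(1) h])
    then have "of_nat (card Q) = of_nat (card {B\<in>Q. B \<inter> ?N = {}})
        + (of_nat (card {v\<in>?N \<inter> V. ?c v Q}) :: complex poly)"
      unfolding of_nat_add[symmetric] by (rule arg_cong)
    moreover have "(\<Sum>v\<in>?N \<inter> V. if ?c v Q then F (card Q) else 0) = of_nat (card {v\<in>?N \<inter> V. ?c v Q}) * F (card Q)"
      using V by (subst sum.inter_filter[symmetric]) auto
    ultimately show ?thesis unfolding F_def falling_poly_Suc by (simp only: algebra_simps)
  qed
  have "cpoly (insert u V) E = (\<Sum>Q\<in>?J. [:0, 1:] * F (card Q)
      - (\<Sum>v\<in>?N \<inter> V. if ?c v Q then F (card Q) else 0))"
    unfolding cpoly_def F_def[symmetric] sum_ind_partitions_insert[OF V irr]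
    by (rule sum.cong[OF refl step])
  also have "\<dots> = (\<Sum>Q\<in>?J. [:0, 1:] * F (card Q)) - (\<Sum>Q\<in>?J. \<Sum>v\<in>?N \<inter> V. if ?c v Q then F (card Q) else 0)"
    by (rule sum_subtractf)
  also have "(\<Sum>Q\<in>?J. [:0, 1:] * F (card Q)) = [:0, 1:] * cpoly V E"
    unfolding cpoly_def F_def by (rule sum_distrib_left[symmetric])
  also have "(\<Sum>Q\<in>?J. \<Sum>v\<in>?N \<inter> V. if ?c v Q then F (card Q) else 0) =
      (\<Sum>v\<in>?N \<inter> V. \<Sum>Q\<in>?J. if ?c v Q then F (card Q) else 0)"
    by (rule sum.swap)
  also have "(\<Sum>v\<in>?N \<inter> V. \<Sum>Q\<in>?J. if ?c v Q then F (card Q) else 0) =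
       (\<Sum>v\<in>?N \<inter> V. cpoly V (star h E u v))"
  proof (rule sum.cong[OF refl])
    fix v assume "v \<in> ?N \<inter> V"
    then show "(\<Sum>Q\<in>?J. if ?c v Q then F (card Q) else 0) = cpoly V (star h E u v)"
      unfolding cpoly_def F_def
      by (simp add: sum.inter_filter finite_ind_partitions V ind_partitions_star)
  qed
  finally show ?thesis .
qed

section \<open>A bound for the chromatic roots\<close>

lemma irrefl_star: "irrefl E \<Longrightarrow> irrefl (star h E u v)"
  by (auto simp: irrefl_def star_def)

text \<open>Every pair added by \<open>star\<close> contains \<open>v\<close>.\<close>

lemma cpoly_star_remove: "cpoly (V - {v}) (star h E u v) = cpoly (V - {v}) E"
  by (rule cpoly_cong) (auto simp: star_def nbrs_iff)

text \<open>The corrections in \<open>cpoly_insert\<close> have degree at most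
  \<open>card V\<close>, too small to affect the leading term of \<open>x P(V, E)\<close>. The
  induction covers all \<open>E\<close> at once because the recursion changes the relation.\<close>

lemma cpoly_monic:
  assumes "finite V" "irrefl E"
  shows "degree (cpoly V E) = card V \<and> coeff (cpoly V E) (card V) = 1"
  using assms
proof (induction V arbitrary: E rule: finite_induct)
  case (insert u V)
  obtain h :: "'a \<Rightarrow> nat" where h: "inj_on h V"
    using finite_imp_inj_to_nat_seg[OF insert.hyps(1)] by blast
  define S where "S = (\<Sum>v\<in>nbrs E u \<inter> V. cpoly V (star h E u v))"
  have rec: "cpoly (insert u V) E = pCons 0 (cpoly V E) - S"
    using cpoly_insert[OF insert.hyps(1,2) _ h, of E] insert.prems
    by (simp add: S_def irrefl_def)
  have deg: "degree S \<le> card V"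
    unfolding S_def using insert.IH[OF irrefl_star[OF insert.prems]] insert.hyps(1)
    by (intro degree_sum_le) auto
  have IH: "degree (cpoly V E) = card V" "coeff (cpoly V E) (card V) = 1"
    using insert.IH[OF insert.prems] by auto
  have "cpoly V E \<noteq> 0" using IH by auto
  then have "degree (pCons 0 (cpoly V E)) = Suc (card V)" using IH by simp
  then have "degree (cpoly (insert u V) E) = Suc (card V)"
    using deg unfolding rec by (metis degree_add_eq_left degree_minus diff_conv_add_uminus le_imp_less_Suc)
  moreover have "coeff S (Suc (card V)) = 0" using deg by (simp add: coeff_eq_0)
  ultimately show ?case using insert.hyps IH by (simp add: rec)
qed simp

lemma degree_cpoly: "finite V \<Longrightarrow> irrefl E \<Longrightarrow> degree (cpoly V E) = card V"
  and lead_coeff_cpoly: "finite V \<Longrightarrow> irrefl E \<Longrightarrow> lead_coeff (cpoly V E) = 1"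
  using cpoly_monic by metis+

text \<open>Both \<open>P(V, E\<^sub>v)\<close> and \<open>P(V, E)\<close> are within a factor of \<open>1 \<plusminus> 1/2\<close> of \<open>x P(V - v, E)\<close>, so
  each of the at most \<open>|V|\<close> correction terms of \<open>x P(V, E)\<close> is bounded by \<open>3 |P(V, E)|\<close>.\<close>

lemma cpoly_insert_bound:
  assumes "finite V" "u \<notin> V" "irrefl E" "x \<noteq> 0" "6 * real (card V) \<le> norm x"
  shows "poly (cpoly V E) x \<noteq> 0 \<and>
    norm (poly (cpoly (insert u V) E) x - x * poly (cpoly V E) x) \<le> norm (x * poly (cpoly V E) x) / 2"
  using assms
proof (induction "card V" arbitrary: V u E rule: less_induct)
  case less
  note V = \<open>finite V\<close> \<open>u \<notin> V\<close> and E = \<open>irrefl E\<close>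
  obtain h :: "'a \<Rightarrow> nat" where h: "inj_on h V"
    using finite_imp_inj_to_nat_seg[OF V(1)] by blast
  \<comment> \<open>As \<open>V\<close> is \<open>insert v (V - {v})\<close>, the induction
    hypothesis compares \<open>P(V)\<close> with \<open>x P(V - v)\<close>, for \<open>E\<close> and
    for \<open>star h E u v\<close> alike.\<close>
  have IH: "poly (cpoly (V - {v}) E') x \<noteq> 0 \<and> norm (poly (cpoly V E') x - x * poly (cpoly (V - {v}) E') x)
       \<le> norm (x * poly (cpoly (V - {v}) E') x) / 2" if "v \<in> V" "irrefl E'" for v E'
  proof -
    have "card (V - {v}) < card V" using V that by (metis card_Diff1_less)
    moreover have "6 * real (card (V - {v})) \<le> norm x" using \<open>6 * real (card V) \<le> norm x\<close> calculation by linarith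
    ultimately show ?thesis using less.hyps[of "V - {v}" v E'] V that \<open>x \<noteq> 0\<close> by (simp add: insert_absorb)
  qed
  \<comment> \<open>For nonempty \<open>V\<close>, the value of \<open>P(V)\<close> is closer to the
    nonzero \<open>x P(V - v)\<close> than zero is.\<close>
  have nz: "poly (cpoly V E) x \<noteq> 0"
  proof (cases "V = {}")
    case False
    then obtain v where v: "v \<in> V" by blast
    show ?thesis
    proof
      assume "poly (cpoly V E) x = 0"
      then have "norm (x * poly (cpoly (V - {v}) E) x) \<le> norm (x * poly (cpoly (V - {v}) E) x) / 2"
        using conjunct2[OF IH[OF v E]] by simp
      moreover have "norm (x * poly (cpoly (V - {v}) E) x) > 0"
        using IH[OF v E] \<open>x \<noteq> 0\<close> by simp
      ultimately show False by linarith
    qed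
  qed simp
  have bound: "norm (poly (cpoly V (star h E u v)) x) \<le> 3 * norm (poly (cpoly V E) x)" if v: "v \<in> V" for v
  proof -
    define y where "y = x * poly (cpoly (V - {v}) E) x"
    have "norm (poly (cpoly V E) x - y) \<le> norm y / 2"
      using IH[OF v E] by (simp add: y_def)
    moreover have "norm (poly (cpoly V (star h E u v)) x - y) \<le> norm y / 2"
      using IH[OF v irrefl_star[OF E, of h u v]] by (simp add: y_def cpoly_star_remove)
    ultimately show ?thesis by norm
  qed
  have "poly (cpoly (insert u V) E) x - x * poly (cpoly V E) x =
      - (\<Sum>v\<in>nbrs E u \<inter> V. poly (cpoly V (star h E u v)) x)"
    using cpoly_insert[OF V _ h, of E] E by (simp add: irrefl_def poly_sum)
  then have "norm (poly (cpoly (insert u V) E) x - x * poly (cpoly V E) x) \<le>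
       (\<Sum>v\<in>nbrs E u \<inter> V. norm (poly (cpoly V (star h E u v)) x))"
    by (simp add: norm_sum)
  also have "\<dots> \<le> (\<Sum>v\<in>nbrs E u \<inter> V. 3 * norm (poly (cpoly V E) x))"
    by (intro sum_mono bound) auto
  also have "\<dots> \<le> (\<Sum>v\<in>V. 3 * norm (poly (cpoly V E) x))"
    using V by (intro sum_mono2) auto
  \<comment> \<open>Origin of the constant 6: \<open>card V\<close> terms, each at most three times
    \<open>norm P(V)\<close>, must not exceed half of \<open>norm (x P(V))\<close>.\<close>
  also have "\<dots> = (6 * real (card V)) * norm (poly (cpoly V E) x) / 2" by simp
  also have "\<dots> \<le> norm x * norm (poly (cpoly V E) x) / 2"
    using \<open>6 * real (card V) \<le> norm x\<close> by (intro divide_right_mono mult_right_mono) auto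
  finally show ?case using nz by (simp add: norm_mult)
qed

text \<open>Beyond this radius \<open>P(V)\<close> deviates from the nonzero
  \<open>x P(V - v)\<close> by at most half of its modulus; for empty \<open>V\<close> the
  polynomial is 1.\<close>

lemma cpoly_root_bound:
  assumes "finite V" "irrefl E" "poly (cpoly V E) x = 0"
  shows "norm x \<le> 6 * real (card V)"
proof (rule ccontr)
  assume "\<not> ?thesis"
  then have x: "6 * real (card V) \<le> norm x" "x \<noteq> 0"
    by auto
  show False
  proof (cases "V = {}")
    case True
    then show ?thesis using assms by simp
  next
    case False
    then obtain v where v: "v \<in> V" by blast
    have "card (V - {v}) \<le> card V" using assms by (simp add: card_mono)
    then have "6 * real (card (V - {v})) \<le> norm x" using x by linarith
    then have "poly (cpoly (V - {v}) E) x \<noteq> 0 \<and> norm (poly (cpoly V E) x - x * poly (cpoly (V - {v}) E) x)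
       \<le> norm (x * poly (cpoly (V - {v}) E) x) / 2"
      using cpoly_insert_bound[of "V - {v}" v E x] assms x v by (simp add: insert_absorb)
    then show ?thesis using assms x by simp
  qed
qed

section \<open>Power sums and the reversed polynomial\<close>

definition psum :: "nat \<Rightarrow> 'a set \<Rightarrow> ('a \<times> 'a) set \<Rightarrow> complex" where
  "psum k V E = (\<Sum>z\<in>#proots (cpoly V E). z ^ k)"

lemma cpoly_nonzero: "finite V \<Longrightarrow> irrefl E \<Longrightarrow> cpoly V E \<noteq> 0"
  using lead_coeff_cpoly by fastforce

lemma norm_psum_le:
  assumes "finite V" "irrefl E"
  shows "norm (psum k V E) \<le> real (card V) * (6 * real (card V)) ^ k"
proof -
  let ?R = "proots (cpoly V E)"
  have "norm (\<Sum>z\<in>#R. z ^ k) \<le> real (size R) * c ^ k"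
    if "\<And>z. z \<in># R \<Longrightarrow> norm z \<le> c" for R :: "complex multiset" and c
    using that
  proof (induction R)
    case (add z R)
    have "norm (z ^ k + (\<Sum>z\<in>#R. z ^ k)) \<le> norm z ^ k + norm (\<Sum>z\<in>#R. z ^ k)"
      using norm_triangle_ineq[of "z ^ k"] by (simp add: norm_power)
    also have "\<dots> \<le> c ^ k + real (size R) * c ^ k"
      using add by (intro add_mono power_mono) auto
    finally show ?case by (simp add: algebra_simps)
  qed simp
  from this[of ?R "6 * real (card V)"] show ?thesis
    using cpoly_root_bound[OF assms] cpoly_nonzero[OF assms] degree_cpoly[OF assms]
    by (simp add: psum_def size_proots_complex)
qed

text \<open>The reversed polynomial \<open>Z(V)\<close>; for a finite loop-free graph it is the
  product of \<open>1 - z t\<close> over the roots \<open>z\<close>. As a formal power series with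
  constant term 1 it can be inverted.\<close>

definition cseries :: "'a set \<Rightarrow> ('a \<times> 'a) set \<Rightarrow> complex fps" where
  "cseries V E = fps_of_poly (reflect_poly (cpoly V E))"

lemma cseries_nth:
  assumes "finite V" "irrefl E"
  shows "cseries V E $ i = (if i \<le> card V then coeff (cpoly V E) (card V - i) else 0)"
  using assms by (simp add: cseries_def coeff_reflect_poly degree_cpoly)

lemma cseries_nth_0: "finite V \<Longrightarrow> irrefl E \<Longrightarrow> cseries V E $ 0 = 1"
  using cpoly_monic[of V E] by (simp add: cseries_nth)

text \<open>Reversal in degree \<open>card V + 1\<close> takes \<open>x P(V, E)\<close> to
  \<open>Z(V)\<close>, while the corrections, of degree \<open>card V\<close> only, gain a factor
  \<open>t\<close>.\<close>

lemma cseries_insert: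
  assumes V: "finite V" "u \<notin> V" and E: "irrefl E" and h: "inj_on h V"
  shows "cseries (insert u V) E = cseries V E - fps_X * (\<Sum>v\<in>nbrs E u \<inter> V. cseries V (star h E u v))"
proof (rule fps_ext)
  fix i
  have rec: "cpoly (insert u V) E = pCons 0 (cpoly V E) - (\<Sum>v\<in>nbrs E u \<inter> V. cpoly V (star h E u v))"
    using cpoly_insert[OF V _ h, of E] E by (simp add: irrefl_def)
  have top: "coeff (cpoly V E') (Suc (card V)) = 0" if "irrefl E'" for E'
    using degree_cpoly[OF V(1) that] by (simp add: coeff_eq_0)
  note nth = cseries_nth[OF V(1) E] cseries_nth[OF V(1) irrefl_star[OF E]]
     cseries_nth[OF finite.insertI[OF V(1)] E]
  show "cseries (insert u V) E $ i =
      (cseries V E - fps_X * (\<Sum>v\<in>nbrs E u \<inter> V. cseries V (star h E u v))) $ i"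
  proof (cases i)
    case 0
    then show ?thesis using V by (simp add: nth rec coeff_sum top irrefl_star[OF E])
  next
    case (Suc j)
    have "coeff (pCons 0 (cpoly V E)) (card V - j) = (if Suc j \<le> card V then coeff (cpoly V E) (card V - Suc j) else 0)"
    proof (cases "Suc j \<le> card V")
      case True
      then have "card V - j = Suc (card V - Suc j)" by simp
      then show ?thesis using True by simp
    qed simp
    then show ?thesis using V Suc
      by (auto simp: nth rec coeff_sum fps_sum_nth)
  qed
qed

text \<open>The operator \<open>t f' / f\<close>; the factor \<open>t\<close> aligns the
  \<open>k\<close>-th coefficient with the \<open>k\<close>-th power sum.\<close>

definition fps_log_deriv :: "complex fps \<Rightarrow> complex fps" where
  "fps_log_deriv f = fps_X * fps_deriv f * inverse f"

lemma fps_log_deriv_mult: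
  assumes "f $ 0 \<noteq> 0" "g $ 0 \<noteq> 0"
  shows "fps_log_deriv (f * g) = fps_log_deriv f + fps_log_deriv g"
proof -
  have "f * inverse f = 1" "g * inverse g = 1"
    using assms by (simp_all add: inverse_mult_eq_1')
  then show ?thesis
    unfolding fps_log_deriv_def fps_inverse_mult fps_deriv_mult by algebra
qed

text \<open>Geometric expansion of \<open>- c t / (1 - c t)\<close>.\<close>

lemma fps_log_deriv_linear:
  "fps_log_deriv (1 - fps_const c * fps_X) $ k = (if k = 0 then 0 else - (c ^ k))"
proof -
  have "(1 - fps_const c * fps_X) * Abs_fps (\<lambda>n. c ^ n) = 1"
  proof (rule fps_ext)
    show "((1 - fps_const c * fps_X) * Abs_fps (\<lambda>n. c ^ n)) $ n = 1 $ n" for n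
      by (cases n) (simp_all add: left_diff_distrib mult.assoc)
  qed
  then have "inverse (1 - fps_const c * fps_X) = Abs_fps (\<lambda>n. c ^ n)"
    by (rule fps_inverse_unique)
  then have "fps_log_deriv (1 - fps_const c * fps_X) = - (fps_const c * (fps_X * Abs_fps (\<lambda>n. c ^ n)))"
    by (simp add: fps_log_deriv_def mult_ac fps_const_neg[symmetric] del: fps_const_neg)
  then show ?thesis by (cases k) simp_all
qed

text \<open>Newton's identities in generating-function form: the logarithmic derivative turns the
  product of \<open>1 - z t\<close> over the roots into a sum. At \<open>k = 0\<close> the
  coefficient vanishes, whereas \<open>psum\<close> counts the roots.\<close>

lemma psum_eq_log_deriv:
  assumes "finite V" "irrefl E" "k > 0"
  shows "psum k V E = - (fps_log_deriv (cseries V E) $ k)"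
proof -
  have refl: "reflect_poly [:- z, 1:] = [:1, - z:]" for z :: complex
    by (rule poly_eqI) (auto simp: coeff_reflect_poly coeff_pCons split: nat.splits)
  have ser: "fps_of_poly (reflect_poly (\<Prod>z\<in>#R. [:- z, 1:])) = (\<Prod>z\<in>#R. 1 - fps_const z * fps_X)" for R :: "complex multiset"
    by (induction R) (simp_all add: reflect_poly_mult refl fps_of_poly_mult fps_of_poly_pCons
        fps_const_neg[symmetric] mult.commute[of fps_X] del: mult_pCons_left fps_const_neg)
  have "(\<Prod>z\<in>#R. 1 - fps_const z * fps_X) $ 0 = 1 \<and>
     (\<Sum>z\<in>#R. z ^ k) = - (fps_log_deriv (\<Prod>z\<in>#R. 1 - fps_const z * fps_X) $ k)" for R :: "complex multiset"
  proof (induction R)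
    case empty
    show ?case by (simp add: fps_log_deriv_def)
  next
    case (add z R)
    then show ?case using assms(3) by (simp add: fps_log_deriv_mult fps_log_deriv_linear)
  qed
  moreover have "cpoly V E = (\<Prod>z\<in>#proots (cpoly V E). [:- z, 1:])"
    using complex_poly_decompose_multiset[of "cpoly V E"] lead_coeff_cpoly[OF assms(1,2)] by simp
  ultimately show ?thesis unfolding psum_def cseries_def using ser[of "proots (cpoly V E)"] by metis
qed

section \<open>Set functions of bounded order\<close>

text \<open>For finite \<open>W\<close> these are the polynomials of degree at most \<open>k\<close>
  in the indicators of the elements of \<open>W\<close>; \<open>g\<close> lists the coefficients of
  the squarefree monomials.\<close>

definition local_of_order :: "nat \<Rightarrow> 'a set \<Rightarrow> ('a set \<Rightarrow> complex) \<Rightarrow> bool" where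
  "local_of_order k W \<phi> \<longleftrightarrow> (\<exists>g. \<forall>T\<subseteq>W. \<phi> T = (\<Sum>S | S \<subseteq> T \<and> card S \<le> k. g S))"

lemma local_of_order_cong:
  "local_of_order k W \<phi> \<Longrightarrow> (\<And>T. T \<subseteq> W \<Longrightarrow> \<phi> T = \<psi> T) \<Longrightarrow> local_of_order k W \<psi>"
  unfolding local_of_order_def by (erule exE, rule_tac x=g in exI) auto

lemma local_of_order_const:
  assumes "finite W"
  shows "local_of_order k W (\<lambda>_. c)"
  unfolding local_of_order_def
proof (intro exI allI impI)
  fix T assume "T \<subseteq> W"
  then have "finite T" using assms finite_subset by blast
  then have "finite {S. S \<subseteq> T \<and> card S \<le> k}" by simp
  then show "c = (\<Sum>S | S \<subseteq> T \<and> card S \<le> k. if S = {} then c else 0)"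
    by (subst sum.delta) auto
qed

lemma local_of_order_add:
  assumes "local_of_order k W \<phi>" "local_of_order k W \<psi>"
  shows "local_of_order k W (\<lambda>T. \<phi> T + \<psi> T)"
proof -
  obtain g g' where "\<And>T. T \<subseteq> W \<Longrightarrow> \<phi> T = (\<Sum>S | S \<subseteq> T \<and> card S \<le> k. g S)"
    "\<And>T. T \<subseteq> W \<Longrightarrow> \<psi> T = (\<Sum>S | S \<subseteq> T \<and> card S \<le> k. g' S)"
    using assms unfolding local_of_order_def by blast
  then show ?thesis unfolding local_of_order_def
    by (intro exI[of _ "\<lambda>S. g S + g' S"]) (simp add: sum.distrib)
qed

lemma local_of_order_cmult:
  assumes "local_of_order k W \<phi>"
  shows "local_of_order k W (\<lambda>T. c * \<phi> T)"
proof -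
  obtain g where "\<And>T. T \<subseteq> W \<Longrightarrow> \<phi> T = (\<Sum>S | S \<subseteq> T \<and> card S \<le> k. g S)"
    using assms unfolding local_of_order_def by blast
  then show ?thesis unfolding local_of_order_def
    by (intro exI[of _ "\<lambda>S. c * g S"]) (simp add: sum_distrib_left)
qed

lemma local_of_order_sum:
  assumes "finite W" "finite I" "\<And>i. i \<in> I \<Longrightarrow> local_of_order k W (\<phi> i)"
  shows "local_of_order k W (\<lambda>T. \<Sum>i\<in>I. \<phi> i T)"
  using assms(2,3)
  by (induction I rule: finite_induct) (auto intro: local_of_order_add local_of_order_const[OF assms(1)])

text \<open>The product of the contributions of \<open>A\<close> and \<open>B\<close> is assigned to
  \<open>A \<union> B\<close>, which has at most \<open>k + l\<close> elements.\<close>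

lemma local_of_order_mult:
  assumes "finite W" "local_of_order k W \<phi>" "local_of_order l W \<psi>"
  shows "local_of_order (k + l) W (\<lambda>T. \<phi> T * \<psi> T)"
proof -
  obtain g g' where g: "\<And>T. T \<subseteq> W \<Longrightarrow> \<phi> T = (\<Sum>S | S \<subseteq> T \<and> card S \<le> k. g S)"
    and g': "\<And>T. T \<subseteq> W \<Longrightarrow> \<psi> T = (\<Sum>S | S \<subseteq> T \<and> card S \<le> l. g' S)"
    using assms unfolding local_of_order_def by blast
  define H where "H S = (\<Sum>(A, B) | A \<union> B = S \<and> card A \<le> k \<and> card B \<le> l. g A * g' B)" for S
  have "\<phi> T * \<psi> T = (\<Sum>S | S \<subseteq> T \<and> card S \<le> k + l. H S)" if T: "T \<subseteq> W" for T
  proof -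
    have "finite T" using T assms(1) finite_subset by blast
    then have fin: "finite {S. S \<subseteq> T \<and> P S}" for P by simp
    let ?X = "{S. S \<subseteq> T \<and> card S \<le> k} \<times> {S. S \<subseteq> T \<and> card S \<le> l}"
    have "\<phi> T * \<psi> T = (\<Sum>(A, B)\<in>?X. g A * g' B)"
      by (simp add: g[OF T] g'[OF T] sum_product sum.cartesian_product)
    also have "\<dots> = (\<Sum>S | S \<subseteq> T \<and> card S \<le> k + l.
        \<Sum>p\<in>{p\<in>?X. (\<lambda>(A, B). A \<union> B) p = S}. (\<lambda>(A, B). g A * g' B) p)"
      using fin by (intro sum.group[symmetric])
        (auto intro: order.trans[OF card_Un_le] add_mono)
    also have "\<dots> = (\<Sum>S | S \<subseteq> T \<and> card S \<le> k + l. H S)"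
      unfolding H_def by (intro sum.cong) auto
    finally show ?thesis .
  qed
  then show ?thesis unfolding local_of_order_def by blast
qed

text \<open>The contributions of sets containing \<open>v\<close> are dropped.\<close>

lemma local_of_order_remove:
  assumes "finite W" "local_of_order k (W - {v}) \<phi>"
  shows "local_of_order k W (\<lambda>T. \<phi> (T - {v}))"
proof -
  obtain g where g: "\<And>T. T \<subseteq> W - {v} \<Longrightarrow> \<phi> T = (\<Sum>S | S \<subseteq> T \<and> card S \<le> k. g S)"
    using assms unfolding local_of_order_def by blast
  have "\<phi> (T - {v}) = (\<Sum>S | S \<subseteq> T \<and> card S \<le> k. if v \<in> S then 0 else g S)" if "T \<subseteq> W" for T
  proof -
    have "T - {v} \<subseteq> W - {v}" using that by auto
    then show ?thesis
      unfolding g[OF \<open>T - {v} \<subseteq> W - {v}\<close>] using assms(1) that finite_subset[OF that]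
      by (intro sum.mono_neutral_cong_left) auto
  qed
  then show ?thesis unfolding local_of_order_def by blast
qed

text \<open>Multiplying by the indicator of \<open>v\<close> moves the contribution of
  \<open>S\<close> to \<open>insert v S\<close>, which costs one order.\<close>

lemma local_of_order_shift:
  assumes "finite W" "local_of_order k (W - {v}) \<phi>"
  shows "local_of_order (Suc k) W (\<lambda>T. if v \<in> T then \<phi> (T - {v}) else 0)"
proof -
  obtain g where g: "\<And>T. T \<subseteq> W - {v} \<Longrightarrow> \<phi> T = (\<Sum>S | S \<subseteq> T \<and> card S \<le> k. g S)"
    using assms unfolding local_of_order_def by blast
  have "(if v \<in> T then \<phi> (T - {v}) else 0) =
      (\<Sum>S | S \<subseteq> T \<and> card S \<le> Suc k. if v \<in> S then g (S - {v}) else 0)" if T: "T \<subseteq> W" for T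
  proof (cases "v \<in> T")
    case True
    have fT: "finite T" using T assms(1) finite_subset by auto
    have "T - {v} \<subseteq> W - {v}" using T by auto
    then have "\<phi> (T - {v}) = (\<Sum>S | S \<subseteq> T - {v} \<and> card S \<le> k. g S)" by (rule g)
    also have "\<dots> = (\<Sum>S | S \<subseteq> T \<and> v \<in> S \<and> card S \<le> Suc k. g (S - {v}))"
    proof (rule sum.reindex_bij_witness[of _ "\<lambda>S. S - {v}" "insert v"])
      fix S assume S: "S \<in> {S. S \<subseteq> T - {v} \<and> card S \<le> k}"
      then have "finite S" "v \<notin> S" using fT finite_subset by auto
      then show "insert v S \<in> {S. S \<subseteq> T \<and> v \<in> S \<and> card S \<le> Suc k}"
        "insert v S - {v} = S" "g (insert v S - {v}) = g S" using S True by auto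
    next
      fix S assume S: "S \<in> {S. S \<subseteq> T \<and> v \<in> S \<and> card S \<le> Suc k}"
      then have "finite S" using fT finite_subset by auto
      then show "S - {v} \<in> {S. S \<subseteq> T - {v} \<and> card S \<le> k}" "insert v (S - {v}) = S" using S by auto
    qed
    also have "\<dots> = (\<Sum>S | S \<subseteq> T \<and> card S \<le> Suc k. if v \<in> S then g (S - {v}) else 0)"
      using fT by (intro sum.mono_neutral_cong_left) auto
    finally show ?thesis using True by simp
  next
    case False
    then have "(\<Sum>S | S \<subseteq> T \<and> card S \<le> Suc k. if v \<in> S then g (S - {v}) else 0) = 0"
      by (intro sum.neutral) auto
    then show ?thesis using False by simp
  qed
  then show ?thesis unfolding local_of_order_def by blast
qed

section \<open>Power series graded by the order of their coefficients\<close>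

definition graded_local :: "'a set \<Rightarrow> ('a set \<Rightarrow> complex fps) \<Rightarrow> bool" where
  "graded_local W F \<longleftrightarrow> (\<forall>k. local_of_order k W (\<lambda>T. F T $ k))"

lemma graded_local_mult:
  assumes "finite W" "graded_local W F" "graded_local W G"
  shows "graded_local W (\<lambda>T. F T * G T)"
  unfolding graded_local_def fps_mult_nth
proof (intro allI local_of_order_sum assms(1))
  fix k i :: nat assume "i \<in> {0..k}"
  then show "local_of_order k W (\<lambda>T. F T $ i * G T $ (k - i))"
    using local_of_order_mult[OF assms(1), of i "\<lambda>T. F T $ i" "k - i" "\<lambda>T. G T $ (k - i)"] assms
    by (simp add: graded_local_def)
qed simp

text \<open>Solving \<open>F * inverse F = 1\<close> for the \<open>k\<close>-th coefficient of the
  inverse leaves products of coefficients with indices \<open>i \<ge> 1\<close> and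
  \<open>k - i\<close>, whose orders add up to \<open>k\<close>.\<close>

lemma graded_local_inverse:
  assumes "finite W" "graded_local W F" "\<And>T. T \<subseteq> W \<Longrightarrow> F T $ 0 = 1"
  shows "graded_local W (\<lambda>T. inverse (F T))"
  unfolding graded_local_def
proof
  fix k
  show "local_of_order k W (\<lambda>T. inverse (F T) $ k)"
  proof (induction k rule: less_induct)
    case (less k)
    show ?case
    proof (cases "k = 0")
      case True
      have "local_of_order k W (\<lambda>_. 1)" by (rule local_of_order_const[OF assms(1)])
      then show ?thesis by (rule local_of_order_cong) (simp add: True assms(3))
    next
      case False
      have "local_of_order k W (\<lambda>T. F T $ i * inverse (F T) $ (k - i))" if "i \<in> {1..k}" for i
        using local_of_order_mult[OF assms(1), of i "\<lambda>T. F T $ i" "k - i" "\<lambda>T. inverse (F T) $ (k - i)"]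
          assms(2) less[of "k - i"] that by (simp add: graded_local_def)
      then have "local_of_order k W (\<lambda>T. (-1) * (\<Sum>i=1..k. F T $ i * inverse (F T) $ (k - i)))"
        by (intro local_of_order_cmult local_of_order_sum assms(1)) auto
      then show ?thesis
      proof (rule local_of_order_cong)
        fix T assume T: "T \<subseteq> W"
        have "0 = (F T * inverse (F T)) $ k"
          using inverse_mult_eq_1'[of "F T"] assms(3)[OF T] False by simp
        also have "\<dots> = (\<Sum>i=0..k. F T $ i * inverse (F T) $ (k - i))" by (rule fps_mult_nth)
        also have "\<dots> = inverse (F T) $ k + (\<Sum>i=1..k. F T $ i * inverse (F T) $ (k - i))"
          using assms(3)[OF T] by (simp add: sum.atLeast_Suc_atMost)
        finally have "(\<Sum>i=1..k. F T $ i * inverse (F T) $ (k - i)) = - (inverse (F T) $ k)"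
          by (metis add_eq_0_iff)
        then show "(-1) * (\<Sum>i=1..k. F T $ i * inverse (F T) $ (k - i)) = inverse (F T) $ k"
          by simp
      qed
    qed
  qed
qed

text \<open>The operator \<open>t d/dt\<close> merely multiplies the \<open>k\<close>-th coefficient
  by \<open>k\<close>.\<close>

lemma graded_local_log_deriv:
  assumes "finite W" "graded_local W F" "\<And>T. T \<subseteq> W \<Longrightarrow> F T $ 0 = 1"
  shows "graded_local W (\<lambda>T. fps_log_deriv (F T))"
proof -
  have "graded_local W (\<lambda>T. fps_X * fps_deriv (F T))"
    unfolding graded_local_def
  proof
    fix k
    have "local_of_order k W (\<lambda>T. of_nat k * F T $ k)"
      using assms(2) by (intro local_of_order_cmult) (simp add: graded_local_def)
    then show "local_of_order k W (\<lambda>T. (fps_X * fps_deriv (F T)) $ k)"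
      by (rule local_of_order_cong) (cases k; simp)
  qed
  then show ?thesis
    unfolding fps_log_deriv_def
    by (rule graded_local_mult[OF assms(1) _ graded_local_inverse[OF assms]])
qed

section \<open>Locality of the power sums\<close>

definition vratio :: "('a \<times> 'a) set \<Rightarrow> 'a \<Rightarrow> 'a set \<Rightarrow> complex fps" where
  "vratio E u T = cseries (insert u T) E * inverse (cseries T E)"

lemma vratio_nth_0: "finite T \<Longrightarrow> irrefl E \<Longrightarrow> vratio E u T $ 0 = 1"
  by (simp add: vratio_def cseries_nth_0)

lemma cseries_inverse: "finite V \<Longrightarrow> irrefl E \<Longrightarrow> cseries V E * inverse (cseries V E) = 1"
  by (simp add: inverse_mult_eq_1' cseries_nth_0)

lemma cseries_star_remove: "cseries (V - {v}) (star h E u v) = cseries (V - {v}) E"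
  by (simp add: cseries_def cpoly_star_remove)

text \<open>Divide \<open>cseries_insert\<close> by \<open>Z(T)\<close>. In the term of
  \<open>v\<close>, numerator and denominator are compared with \<open>Z(T - v)\<close>, which is
  the same for \<open>E\<close> and \<open>star h E u v\<close>.\<close>

lemma vratio_rec:
  assumes T: "finite T" "u \<notin> T" and E: "irrefl E" and h: "inj_on h T"
  shows "vratio E u T = 1 - fps_X *
    (\<Sum>v\<in>nbrs E u \<inter> T. vratio (star h E u v) v (T - {v}) * inverse (vratio E v (T - {v})))"
proof -
  have *: "cseries T (star h E u v) * inverse (cseries T E) =
       vratio (star h E u v) v (T - {v}) * inverse (vratio E v (T - {v}))" if "v \<in> T" for v
  proof -
    have "inverse (inverse (cseries (T - {v}) E)) = cseries (T - {v}) E"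
      using T E by (intro fps_inverse_idempotent) (simp add: cseries_nth_0)
    moreover have "cseries (T - {v}) E * inverse (cseries (T - {v}) E) = 1"
      using T E by (intro cseries_inverse) auto
    ultimately show ?thesis
      unfolding vratio_def fps_inverse_mult cseries_star_remove
      using that by (simp add: insert_absorb mult_ac)
  qed
  have "vratio E u T = cseries T E * inverse (cseries T E)
      - fps_X * (\<Sum>v\<in>nbrs E u \<inter> T. cseries T (star h E u v) * inverse (cseries T E))"
    unfolding vratio_def cseries_insert[OF T E h] by (simp add: left_diff_distrib sum_distrib_right mult.assoc)
  then show ?thesis using * T E by (simp add: cseries_inverse)
qed

text \<open>In \<open>vratio_rec\<close> the summand of \<open>v\<close> depends on \<open>T\<close>
  only through the indicator of \<open>v\<close> and quotients at \<open>T - {v}\<close>, which are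
  graded by induction. The indicator raises the order by one, and the factor \<open>t\<close>
  compensates for this.\<close>

lemma graded_local_vratio:
  assumes "finite W" "u \<notin> W" "irrefl E"
  shows "graded_local W (vratio E u)"
  using assms
proof (induction "card W" arbitrary: W u E rule: less_induct)
  case less
  note W = \<open>finite W\<close> \<open>u \<notin> W\<close> and E = \<open>irrefl E\<close>
  obtain h :: "'a \<Rightarrow> nat" where h: "inj_on h W"
    using finite_imp_inj_to_nat_seg[OF W(1)] by blast
  define q where "q v T = vratio (star h E u v) v T * inverse (vratio E v T)" for v T
  have q: "graded_local (W - {v}) (q v)" if v: "v \<in> W" for v
  proof -
    have "card (W - {v}) < card W" using W v by (metis card_Diff1_less)
    then have "graded_local (W - {v}) (vratio E' v)" if "irrefl E'" for E'
      using less.hyps[of "W - {v}" v E'] W that by simp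
    then show ?thesis unfolding q_def
      using W E irrefl_star[OF E] finite_subset[of _ "W - {v}"]
      by (intro graded_local_mult graded_local_inverse) (auto intro!: vratio_nth_0)
  qed
  \<comment> \<open>The range of summation is made independent of \<open>T\<close> by means of the
    indicator of \<open>v\<close>.\<close>
  have rec: "vratio E u T = 1 - fps_X * (\<Sum>v\<in>nbrs E u \<inter> W. if v \<in> T then q v (T - {v}) else 0)"
    if T: "T \<subseteq> W" for T
  proof -
    have "vratio E u T = 1 - fps_X * (\<Sum>v\<in>nbrs E u \<inter> T. q v (T - {v}))"
      unfolding q_def using T W E h by (intro vratio_rec) (auto intro: finite_subset inj_on_subset)
    also have "(\<Sum>v\<in>nbrs E u \<inter> T. q v (T - {v})) = (\<Sum>v\<in>nbrs E u \<inter> W. if v \<in> T then q v (T - {v}) else 0)"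
      using T W by (intro sum.mono_neutral_cong_left) auto
    finally show ?thesis .
  qed
  show ?case unfolding graded_local_def
  proof
    fix k
    show "local_of_order k W (\<lambda>T. vratio E u T $ k)"
    proof (cases k)
      case 0
      have "local_of_order k W (\<lambda>_. 1)" by (rule local_of_order_const[OF W(1)])
      then show ?thesis by (rule local_of_order_cong) (simp add: rec 0)
    next
      case (Suc j)
      have "local_of_order k W (\<lambda>T. (-1) * (\<Sum>v\<in>nbrs E u \<inter> W. if v \<in> T then q v (T - {v}) $ j else 0))"
        unfolding Suc using q W
        by (intro local_of_order_cmult local_of_order_sum local_of_order_shift)
           (auto simp: graded_local_def)
      then show ?thesis
        by (rule local_of_order_cong) (simp add: rec Suc fps_sum_nth if_distrib[of "\<lambda>f. f $ j"] cong: if_cong)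
    qed
  qed
qed

text \<open>The number of vertices involved exceeds the order \<open>k\<close> by only one: this is what makes the
  normalisation by \<open>n\<^bsup>k+1\<^esup>\<close> the right one.\<close>

lemma local_of_order_log_deriv_cseries:
  assumes "finite V" "irrefl E"
  shows "local_of_order (Suc k) V (\<lambda>T. fps_log_deriv (cseries T E) $ k)"
  using assms(1)
proof (induction V rule: finite_induct)
  case empty
  have "local_of_order (Suc k) {} (\<lambda>_::'a set. fps_log_deriv (cseries {} E) $ k)"
    by (rule local_of_order_const) simp
  then show ?case by (rule local_of_order_cong) simp
next
  case (insert u W)
  have eq: "insert u W - {u} = W" using insert.hyps by auto
  let ?L = "\<lambda>T. fps_log_deriv (cseries T E) $ k"
  have "graded_local W (\<lambda>T. fps_log_deriv (vratio E u T))"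
    using insert.hyps assms(2)
    by (intro graded_local_log_deriv graded_local_vratio) (auto intro!: vratio_nth_0 intro: finite_subset)
  \<comment> \<open>The indicator of \<open>u\<close> accounts for the passage from \<open>k\<close>
    to \<open>Suc k\<close>.\<close>
  then have "local_of_order (Suc k) (insert u W) (\<lambda>T. if u \<in> T then fps_log_deriv (vratio E u (T - {u})) $ k else 0)"
    using insert.hyps by (intro local_of_order_shift) (auto simp: graded_local_def eq)
  moreover have "local_of_order (Suc k) (insert u W) (\<lambda>T. ?L (T - {u}))"
    using insert by (intro local_of_order_remove) (auto simp: eq)
  ultimately have "local_of_order (Suc k) (insert u W) (\<lambda>T. ?L (T - {u}) +
      (if u \<in> T then fps_log_deriv (vratio E u (T - {u})) $ k else 0))"
    by (rule local_of_order_add[rotated])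
  then show ?case
  proof (rule local_of_order_cong)
    fix T assume T: "T \<subseteq> insert u W"
    have fT: "finite T" using T insert.hyps finite_subset by blast
    show "?L (T - {u}) + (if u \<in> T then fps_log_deriv (vratio E u (T - {u})) $ k else 0) = ?L T"
    proof (cases "u \<in> T")
      case True
      \<comment> \<open>\<open>Z(T)\<close> is \<open>Z(T - u)\<close> times the ratio, and
        logarithmic derivatives of products add up.\<close>
      have "cseries T E = cseries (T - {u}) E * vratio E u (T - {u})"
        using cseries_inverse[of "T - {u}" E] fT assms(2) True
        by (simp add: vratio_def insert_absorb mult_ac)
      then show ?thesis using True fT assms(2)
        by (simp add: fps_log_deriv_mult vratio_nth_0 cseries_nth_0)
    qed simp
  qed
qed

lemma psum_local:
  assumes "finite V" "irrefl E" "k > 0"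
  shows "local_of_order (Suc k) V (\<lambda>T. psum k T E)"
  by (rule local_of_order_cong[OF local_of_order_cmult[where c="-1", OF local_of_order_log_deriv_cseries]])
     (use assms in \<open>auto simp: psum_eq_log_deriv finite_subset\<close>)

section \<open>Moebius inversion and homomorphism numbers\<close>

definition pull :: "('b \<Rightarrow> 'a) \<Rightarrow> ('a \<times> 'a) set \<Rightarrow> ('b \<times> 'b) set" where
  "pull \<phi> E = {(i, j). (\<phi> i, \<phi> j) \<in> E}"

lemma irrefl_pull: "irrefl E \<Longrightarrow> irrefl (pull \<phi> E)"
  by (auto simp: irrefl_def pull_def)

lemma nbrs_pull: "v \<in> nbrs (pull \<phi> E) u \<longleftrightarrow> \<phi> v \<in> nbrs E (\<phi> u)"
  by (auto simp: nbrs_iff pull_def)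

text \<open>Isomorphism invariance, by running the recursion on both sides with the orders
  \<open>h\<close> and \<open>h \<circ> \<phi>\<close>; the two versions of \<open>E\<^sub>v\<close>
  agree on \<open>V\<close> because \<open>\<phi>\<close> is injective there.\<close>

lemma cpoly_image:
  fixes \<phi> :: "'b \<Rightarrow> 'a"
  assumes "finite V" "inj_on \<phi> V" "irrefl E"
  shows "cpoly (\<phi> ` V) E = cpoly V (pull \<phi> E)"
  using assms
proof (induction V arbitrary: E rule: finite_induct)
  case (insert u V)
  obtain h :: "'a \<Rightarrow> nat" where h: "inj_on h (\<phi> ` V)"
    using finite_imp_inj_to_nat_seg[of "\<phi> ` V"] insert.hyps(1) by blast
  have inj: "inj_on \<phi> V" and u: "\<phi> u \<notin> \<phi> ` V" using insert.prems insert.hyps by auto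
  have hp: "inj_on (h \<circ> \<phi>) V" using inj h by (rule comp_inj_on)
  have irr: "(\<phi> u, \<phi> u) \<notin> E" "(u, u) \<notin> pull \<phi> E"
    using insert.prems by (auto simp: irrefl_def pull_def)
  have "cpoly (\<phi> ` insert u V) E = [:0, 1:] * cpoly (\<phi> ` V) E
      - (\<Sum>w\<in>nbrs E (\<phi> u) \<inter> \<phi> ` V. cpoly (\<phi> ` V) (star h E (\<phi> u) w))"
    using cpoly_insert[OF _ u irr(1) h] insert.hyps by simp
  also have "cpoly (\<phi> ` V) E = cpoly V (pull \<phi> E)"
    by (rule insert.IH[OF inj insert.prems(2)])
  also have "(\<Sum>w\<in>nbrs E (\<phi> u) \<inter> \<phi> ` V. cpoly (\<phi> ` V) (star h E (\<phi> u) w)) =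
      (\<Sum>v\<in>nbrs (pull \<phi> E) u \<inter> V. cpoly V (star (h \<circ> \<phi>) (pull \<phi> E) u v))"
  proof -
    have "nbrs E (\<phi> u) \<inter> \<phi> ` V = \<phi> ` (nbrs (pull \<phi> E) u \<inter> V)"
      by (auto simp: nbrs_pull)
    moreover have "inj_on \<phi> (nbrs (pull \<phi> E) u \<inter> V)" using inj by (rule inj_on_subset) auto
    moreover have "cpoly (\<phi> ` V) (star h E (\<phi> u) (\<phi> v)) = cpoly V (star (h \<circ> \<phi>) (pull \<phi> E) u v)"
      if v: "v \<in> V" for v
    proof -
      have "cpoly (\<phi> ` V) (star h E (\<phi> u) (\<phi> v)) = cpoly V (pull \<phi> (star h E (\<phi> u) (\<phi> v)))"
        by (rule insert.IH[OF inj irrefl_star[OF insert.prems(2)]])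
      also have "\<dots> = cpoly V (star (h \<circ> \<phi>) (pull \<phi> E) u v)"
      proof (rule cpoly_cong)
        fix a b assume "a \<in> V" "b \<in> V"
        then have "\<phi> a = \<phi> v \<longleftrightarrow> a = v" "\<phi> b = \<phi> v \<longleftrightarrow> b = v"
          using inj v by (auto simp: inj_on_def)
        then show "b \<in> nbrs (pull \<phi> (star h E (\<phi> u) (\<phi> v))) a \<longleftrightarrow>
            b \<in> nbrs (star (h \<circ> \<phi>) (pull \<phi> E) u v) a"
          by (auto simp: nbrs_iff pull_def star_def)
      qed
      finally show ?thesis .
    qed
    ultimately show ?thesis by (simp add: sum.reindex)
  qed
  also have "[:0, 1:] * cpoly V (pull \<phi> E)
      - (\<Sum>v\<in>nbrs (pull \<phi> E) u \<inter> V. cpoly V (star (h \<circ> \<phi>) (pull \<phi> E) u v)) =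
      cpoly (insert u V) (pull \<phi> E)"
    using cpoly_insert[OF insert.hyps irr(2) hp] by simp
  finally show ?case .
qed simp

text \<open>The Moebius transform of \<open>psum\<close> on the lattice of subsets. It makes the
  contribution of \<open>V\<close> explicit and shows that it depends only on the graph induced on
  \<open>V\<close>.\<close>

definition psum_mobius :: "nat \<Rightarrow> 'a set \<Rightarrow> ('a \<times> 'a) set \<Rightarrow> complex" where
  "psum_mobius k V E = (\<Sum>T\<in>Pow V. (-1) ^ (card V - card T) * psum k T E)"

text \<open>Locality provides some coefficient function \<open>g\<close>; Moebius inversion
  identifies it with the explicit transform.\<close>

lemma psum_eq_sum_mobius:
  assumes V: "finite V" "irrefl E" "k > 0"
  shows "psum k V E = (\<Sum>S | S \<subseteq> V \<and> card S \<le> Suc k. psum_mobius k S E)"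
proof -
  obtain g where g: "\<And>T. T \<subseteq> V \<Longrightarrow> psum k T E = (\<Sum>S | S \<subseteq> T \<and> card S \<le> Suc k. g S)"
    using psum_local[OF assms] unfolding local_of_order_def by blast
  \<comment> \<open>Extension by zero turns the restricted sum into one over all subsets, to which
    the inversion formula applies.\<close>
  define g' where "g' S = (if card S \<le> Suc k then g S else 0)" for S
  have psum: "psum k T E = sum g' (Pow T)" if "T \<subseteq> V" for T
    unfolding g[OF that] g'_def using finite_subset[OF that V(1)]
    by (intro sum.mono_neutral_cong_left) auto
  have "g' S = psum_mobius k S E" if "S \<subseteq> V" for S
  proof -
    have "g' S = (\<Sum>T\<in>Pow S. (-1) ^ (card S - card T) * sum g' (Pow T))"
      by (rule inclusion_exclusion_mobius) (use that V finite_subset in auto)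
    also have "\<dots> = psum_mobius k S E"
      unfolding psum_mobius_def using that by (intro sum.cong refl) (auto simp: psum)
    finally show ?thesis .
  qed
  then have "g S = psum_mobius k S E" if "S \<subseteq> V" "card S \<le> Suc k" for S
    using that unfolding g'_def by metis
  then show ?thesis unfolding g[OF order.refl] by (intro sum.cong) auto
qed

lemma norm_psum_mobius_le:
  assumes "finite V" "irrefl E"
  shows "norm (psum_mobius k V E) \<le> 2 ^ card V * (real (card V) * (6 * real (card V)) ^ k)"
proof -
  have "norm (psum_mobius k V E) \<le> (\<Sum>T\<in>Pow V. norm ((-1) ^ (card V - card T) * psum k T E))"
    unfolding psum_mobius_def by (rule norm_sum)
  also have "\<dots> \<le> (\<Sum>T\<in>Pow V. real (card V) * (6 * real (card V)) ^ k)"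
  proof (rule sum_mono)
    fix T assume "T \<in> Pow V"
    then have T: "finite T" "card T \<le> card V" using assms finite_subset by (auto simp: card_mono)
    have "norm ((-1) ^ (card V - card T) * psum k T E) = norm (psum k T E)"
      by (simp add: norm_mult norm_power)
    also have "\<dots> \<le> real (card T) * (6 * real (card T)) ^ k" by (rule norm_psum_le[OF T(1) assms(2)])
    also have "\<dots> \<le> real (card V) * (6 * real (card V)) ^ k"
      using T by (intro mult_mono power_mono) auto
    finally show "norm ((-1) ^ (card V - card T) * psum k T E) \<le> real (card V) * (6 * real (card V)) ^ k" .
  qed
  also have "\<dots> = 2 ^ card V * (real (card V) * (6 * real (card V)) ^ k)"
    by (simp add: card_Pow assms)
  finally show ?thesis .
qed

lemma psum_mobius_cong:
  assumes "\<And>u v. u \<in> V \<Longrightarrow> v \<in> V \<Longrightarrow> v \<in> nbrs E u \<longleftrightarrow> v \<in> nbrs E' u"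
  shows "psum_mobius k V E = psum_mobius k V E'"
proof -
  have "cpoly T E = cpoly T E'" if "T \<in> Pow V" for T
    using that assms by (intro cpoly_cong) blast
  then show ?thesis unfolding psum_mobius_def psum_def by (intro sum.cong) auto
qed

lemma psum_mobius_image:
  assumes "finite V" "inj_on \<phi> V" "irrefl E"
  shows "psum_mobius k (\<phi> ` V) E = psum_mobius k V (pull \<phi> E)"
proof -
  have inj: "inj_on \<phi> T" if "T \<in> Pow V" for T using that assms inj_on_subset by blast
  have "psum_mobius k (\<phi> ` V) E =
      (\<Sum>T\<in>Pow V. (-1) ^ (card (\<phi> ` V) - card (\<phi> ` T)) * psum k (\<phi> ` T) E)"
    unfolding psum_mobius_def
    by (subst image_Pow_surj[OF refl, symmetric], subst sum.reindex)
       (use inj_on_image_Pow[OF assms(2)] in auto)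
  also have "\<dots> = psum_mobius k V (pull \<phi> E)"
    unfolding psum_mobius_def
  proof (rule sum.cong[OF refl])
    fix T assume T: "T \<in> Pow V"
    have "psum k (\<phi> ` T) E = psum k T (pull \<phi> E)"
      using cpoly_image[OF _ inj[OF T] assms(3)] T assms(1) finite_subset[of T V] by (auto simp: psum_def)
    then show "(-1) ^ (card (\<phi> ` V) - card (\<phi> ` T)) * psum k (\<phi> ` T) E =
        (-1) ^ (card V - card T) * psum k T (pull \<phi> E)"
      using inj[OF T] assms(2) by (simp add: card_image)
  qed
  finally show ?thesis .
qed

text \<open>Every \<open>m\<close>-element set is the image of exactly \<open>fact m\<close>
  injections of \<open>{..<m}\<close>.\<close>

lemma sum_subsets_eq_sum_injections:
  fixes c :: "'a set \<Rightarrow> 'b :: {comm_semiring_1, semiring_char_0}"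
  assumes V: "finite V"
  shows "(\<Sum>\<phi> | \<phi> \<in> {..<m} \<rightarrow>\<^sub>E V \<and> inj_on \<phi> {..<m}. c (\<phi> ` {..<m})) =
    fact m * (\<Sum>S | S \<subseteq> V \<and> card S = m. c S)"
proof -
  let ?I = "{\<phi>. \<phi> \<in> {..<m} \<rightarrow>\<^sub>E V \<and> inj_on \<phi> {..<m}}"
  have finI: "finite ?I"
    by (rule finite_subset[OF _ finite_PiE[of "{..<m}" "\<lambda>_. V"]]) (use V in auto)
  have "(\<Sum>\<phi>\<in>?I. c (\<phi> ` {..<m})) =
      (\<Sum>S | S \<subseteq> V \<and> card S = m. \<Sum>\<phi>\<in>{\<phi>\<in>?I. \<phi> ` {..<m} = S}. c (\<phi> ` {..<m}))"
  proof (rule sum.group[symmetric])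
    show "finite {S. S \<subseteq> V \<and> card S = m}" using V by simp
    show "(\<lambda>\<phi>. \<phi> ` {..<m}) ` ?I \<subseteq> {S. S \<subseteq> V \<and> card S = m}"
      using card_image[of _ "{..<m}"] by (force dest: PiE_mem)
  qed (fact finI)
  also have "\<dots> = (\<Sum>S | S \<subseteq> V \<and> card S = m. fact m * c S)"
  proof (rule sum.cong[OF refl])
    fix S assume "S \<in> {S. S \<subseteq> V \<and> card S = m}"
    then have S: "S \<subseteq> V" "card S = m" "finite S" using V finite_subset by auto
    have "{\<phi>\<in>?I. \<phi> ` {..<m} = S} = {\<phi>\<in>{..<m} \<rightarrow>\<^sub>E S. inj_on \<phi> {..<m}}"
    proof (intro set_eqI iffI)
      fix \<phi> assume p: "\<phi> \<in> {\<phi>\<in>{..<m} \<rightarrow>\<^sub>E S. inj_on \<phi> {..<m}}"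
      then have "\<phi> ` {..<m} \<subseteq> S" "card (\<phi> ` {..<m}) = card S" using S by (auto simp: card_image)
      then have "\<phi> ` {..<m} = S" using S card_subset_eq by blast
      then show "\<phi> \<in> {\<phi>\<in>?I. \<phi> ` {..<m} = S}" using p S by (auto simp: PiE_iff)
    qed (auto simp: PiE_iff)
    moreover have "card {\<phi>\<in>{..<m} \<rightarrow>\<^sub>E S. inj_on \<phi> {..<m}} = fact m"
      using card_inj_on_subset_funcset[of "{..<m}" S "{..<m}"] S
      by (simp add: fact_prod_rev)
    ultimately have "(\<Sum>\<phi>\<in>{\<phi>\<in>?I. \<phi> ` {..<m} = S}. c S) = fact m * c S" by simp
    moreover have "(\<Sum>\<phi>\<in>{\<phi>\<in>?I. \<phi> ` {..<m} = S}. c (\<phi> ` {..<m})) = (\<Sum>\<phi>\<in>{\<phi>\<in>?I. \<phi> ` {..<m} = S}. c S)"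
      by (rule sum.cong) auto
    ultimately show "(\<Sum>\<phi>\<in>{\<phi>\<in>?I. \<phi> ` {..<m} = S}. c (\<phi> ` {..<m})) = fact m * c S"
      by simp
  qed
  finally show ?thesis by (simp add: sum_distrib_left)
qed

section \<open>Inversion over edge sets\<close>

definition upper_arcs :: "nat \<Rightarrow> (nat \<times> nat) set" where
  "upper_arcs m = {(i, j). i < j \<and> j < m}"

lemma finite_upper_arcs: "finite (upper_arcs m)"
  by (rule finite_subset[of _ "{..<m} \<times> {..<m}"]) (auto simp: upper_arcs_def)

text \<open>\<open>F\<close> is meant to list each edge once, oriented upwards, so that the subsets
  of \<open>upper_arcs m\<close> stand for the labelled graphs on \<open>{..<m}\<close>.\<close>

definition test_graph :: "nat \<Rightarrow> (nat \<times> nat) set \<Rightarrow> nat pair_pre_digraph" where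
  "test_graph m F = \<lparr>pverts = {..<m}, parcs = F \<union> F\<inverse>\<rparr>"

lemma pair_graph_test_graph:
  assumes "F \<subseteq> upper_arcs m"
  shows "pair_graph (test_graph m F)"
proof -
  have "finite F" using assms finite_upper_arcs finite_subset by blast
  then show ?thesis
    using assms by unfold_locales (auto simp: test_graph_def upper_arcs_def symmetric_def sym_def)
qed

lemma pair_graph_parcs:
  assumes "pair_graph G"
  shows "finite (pverts G)" "irrefl (parcs G)" "sym (parcs G)"
proof -
  interpret pair_graph G by fact
  show "finite (pverts G)" by (rule pair_finite_verts)
  show "irrefl (parcs G)" using pair_no_loops by (fastforce simp: irrefl_def)
  show "sym (parcs G)" using pair_sym_arcs by (simp add: symmetric_def)
qed

lemma hom_count_test_graph:
  assumes "sym (parcs G)" "F \<subseteq> upper_arcs m"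
  shows "hom_count (test_graph m F) G = card {\<phi> \<in> {..<m} \<rightarrow>\<^sub>E pverts G. F \<subseteq> pull \<phi> (parcs G)}"
  unfolding hom_count_def graph_homs_def
  by (rule arg_cong[where f=card])
     (use assms in \<open>auto simp: test_graph_def pull_def dest: symD\<close>)

text \<open>The Moebius transform over edge sets with the vertices fixed: \<open>psum_mobius\<close>
  becomes the sum of \<open>hom_coeff\<close> over all spanning subgraphs.\<close>

definition hom_coeff :: "nat \<Rightarrow> nat \<Rightarrow> (nat \<times> nat) set \<Rightarrow> complex" where
  "hom_coeff k m F = (\<Sum>B\<in>Pow F. (-1) ^ (card F - card B) * psum_mobius k {..<m} B)"

lemma sum_psum_mobius_eq_homs:
  assumes G: "pair_graph G"
  shows "(\<Sum>\<phi>\<in>{..<m} \<rightarrow>\<^sub>E pverts G. psum_mobius k {..<m} (pull \<phi> (parcs G))) =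
    (\<Sum>F\<in>Pow (upper_arcs m). hom_coeff k m F * of_nat (hom_count (test_graph m F) G))"
proof -
  let ?U = "upper_arcs m" and ?H = "{..<m} \<rightarrow>\<^sub>E pverts G" and ?E = "parcs G"
  note g = pair_graph_parcs[OF G]
  have finH: "finite ?H" using g by (intro finite_PiE) auto
  have D: "psum_mobius k {..<m} A = sum (hom_coeff k m) (Pow A)" if "finite A" for A
  proof -
    \<comment> \<open>The signs bring the transform into the self-inverse form of
      inclusion-exclusion.\<close>
    have alt: "(-1) ^ card S * hom_coeff k m S = (\<Sum>T\<in>Pow S. (-1) ^ card T * psum_mobius k {..<m} T)" if "finite S" for S
      unfolding hom_coeff_def sum_distrib_left
    proof (rule sum.cong[OF refl])
      fix T assume "T \<in> Pow S"
      then have "card T \<le> card S" using \<open>finite S\<close> by (simp add: card_mono)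
      then obtain d where "card S = card T + d" using le_Suc_ex by blast
      then show "(-1) ^ card S * ((-1) ^ (card S - card T) * psum_mobius k {..<m} T) =
          (-1) ^ card T * psum_mobius k {..<m} T"
        by (simp add: power_add)
    qed
    have "psum_mobius k {..<m} A = (\<Sum>T\<in>Pow A. (-1) ^ card T * ((-1) ^ card T * hom_coeff k m T))"
      by (rule inclusion_exclusion_symmetric[where g = "\<lambda>T. (-1) ^ card T * hom_coeff k m T", OF alt that])
    then show ?thesis by (simp flip: mult.assoc power_mult_distrib)
  qed
  have "psum_mobius k {..<m} (pull \<phi> ?E) = (\<Sum>F\<in>Pow ?U. if F \<subseteq> pull \<phi> ?E then hom_coeff k m F else 0)" for \<phi>
  proof -
    \<comment> \<open>The pullback is symmetric and loop-free, so its upward pairs determine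
      adjacency on \<open>{..<m}\<close>.\<close>
    have "psum_mobius k {..<m} (pull \<phi> ?E) = psum_mobius k {..<m} (pull \<phi> ?E \<inter> ?U)"
    proof (rule psum_mobius_cong)
      fix u v assume uv: "u \<in> {..<m}" "v \<in> {..<m}"
      show "v \<in> nbrs (pull \<phi> ?E) u \<longleftrightarrow> v \<in> nbrs (pull \<phi> ?E \<inter> ?U) u"
        using uv g(2,3) by (cases u v rule: linorder_cases)
          (auto simp: nbrs_iff pull_def upper_arcs_def irrefl_def dest: symD)
    qed
    also have "\<dots> = sum (hom_coeff k m) (Pow (pull \<phi> ?E \<inter> ?U))" by (rule D) (simp add: finite_upper_arcs)
    also have "\<dots> = (\<Sum>F\<in>Pow ?U. if F \<subseteq> pull \<phi> ?E then hom_coeff k m F else 0)"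
      by (intro sum.mono_neutral_cong_left) (auto simp: finite_upper_arcs)
    finally show ?thesis .
  qed
  then have "(\<Sum>\<phi>\<in>?H. psum_mobius k {..<m} (pull \<phi> ?E)) =
      (\<Sum>F\<in>Pow ?U. \<Sum>\<phi>\<in>?H. if F \<subseteq> pull \<phi> ?E then hom_coeff k m F else 0)"
    by (simp only:) (rule sum.swap)
  also have "\<dots> = (\<Sum>F\<in>Pow ?U. hom_coeff k m F * of_nat (hom_count (test_graph m F) G))"
    using finH g by (intro sum.cong refl) (simp add: sum.inter_filter[symmetric] hom_count_test_graph mult.commute)
  finally show ?thesis .
qed

section \<open>Convergence of the moments\<close>

lemma card_small_subsets_le:
  assumes "finite V" "V \<noteq> {}"
  shows "card {S. S \<subseteq> V \<and> card S \<le> k} \<le> Suc k * card V ^ k"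
proof -
  have "{S. S \<subseteq> V \<and> card S \<le> k} = (\<Union>j\<in>{..k}. {S. S \<subseteq> V \<and> card S = j})" by auto
  then have "card {S. S \<subseteq> V \<and> card S \<le> k} \<le> (\<Sum>j\<le>k. card {S. S \<subseteq> V \<and> card S = j})"
    by (simp add: card_UN_le)
  also have "\<dots> = (\<Sum>j\<le>k. card V choose j)" using assms by (simp add: n_subsets)
  also have "\<dots> \<le> (\<Sum>j\<le>k. card V ^ k)"
  proof (rule sum_mono)
    fix j assume "j \<in> {..k}"
    have "card V choose j \<le> card V ^ j"
      by (cases "j \<le> card V") (auto intro: binomial_le_pow simp: binomial_eq_0)
    also have "\<dots> \<le> card V ^ k"
      using \<open>j \<in> {..k}\<close> assms by (intro power_increasing) (auto simp: Suc_le_eq card_gt_0_iff)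
    finally show "card V choose j \<le> card V ^ k" .
  qed
  finally show ?thesis by simp
qed

text \<open>The number of non-injective maps from an \<open>m\<close>-set to an
  \<open>n\<close>-set. Truncated subtraction is correct here: for \<open>n < m\<close> the factor
  with \<open>i = n\<close> makes the product vanish.\<close>

definition noninj_count :: "nat \<Rightarrow> nat \<Rightarrow> nat" where
  "noninj_count m n = n ^ m - (\<Prod>i<m. n - i)"

lemma noninj_count_tendsto: "(\<lambda>n. real (noninj_count m n) / real n ^ m) \<longlonglongrightarrow> 0"
proof -
  have "(\<lambda>n. 1 - (\<Prod>i<m. (real n - real i) / real n)) \<longlonglongrightarrow> 1 - (\<Prod>i<m. 1)"
    by (intro tendsto_intros) real_asymp
  moreover have "\<forall>\<^sub>F n in sequentially. 1 - (\<Prod>i<m. (real n - real i) / real n) =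
      real (noninj_count m n) / real n ^ m"
    using eventually_ge_at_top[of "Suc m"]
  proof eventually_elim
    case (elim n)
    have "(\<Prod>i<m. n - i) \<le> (\<Prod>i<m. n)" by (intro prod_mono) auto
    then have "real (noninj_count m n) = real n ^ m - (\<Prod>i<m. real (n - i))"
      by (simp add: noninj_count_def of_nat_diff)
    also have "(\<Prod>i<m. real (n - i)) = (\<Prod>i<m. real n - real i)"
      using elim by (intro prod.cong) auto
    finally show ?case using elim by (simp add: prod_dividef) (simp add: diff_divide_distrib)
  qed
  ultimately show ?thesis by (auto elim: Lim_transform_eventually)
qed

definition mobius_bound :: "nat \<Rightarrow> real" where
  "mobius_bound k = 2 ^ Suc k * (real (Suc k) * (6 * real (Suc k)) ^ k)"

lemma norm_psum_mobius_le_bound: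
  assumes "finite V" "irrefl E" "card V \<le> Suc k"
  shows "norm (psum_mobius k V E) \<le> mobius_bound k"
proof -
  have "norm (psum_mobius k V E) \<le> 2 ^ card V * (real (card V) * (6 * real (card V)) ^ k)"
    by (rule norm_psum_mobius_le[OF assms(1,2)])
  also have "\<dots> \<le> mobius_bound k"
    unfolding mobius_bound_def using assms(3)
    by (intro mult_mono power_mono power_increasing) auto
  finally show ?thesis .
qed

text \<open>The sum of \<open>psum_eq_sum_mobius\<close> is split by the size of the subsets. Sizes
  up to \<open>k\<close> give the first error term. For size \<open>Suc k\<close>, the sum over sets
  becomes one over injections and then over all maps, at the price of the second error term.\<close>

lemma psum_hom_estimate:
  assumes G: "pair_graph G" and ne: "num_verts G > 0" and k: "k > 0"
  defines "n \<equiv> num_verts G"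
  shows "norm (psum k (pverts G) (parcs G) -
      (\<Sum>F\<in>Pow (upper_arcs (Suc k)). hom_coeff k (Suc k) F * of_nat (hom_count (test_graph (Suc k) F) G)) / fact (Suc k))
    \<le> mobius_bound k * (real (Suc k) * real n ^ k + real (noninj_count (Suc k) n))"
proof -
  define m where "m = Suc k"
  define V where "V = pverts G"
  define E where "E = parcs G"
  define B where "B = mobius_bound k"
  define H where "H = {..<m} \<rightarrow>\<^sub>E V"
  define c where "c \<phi> = psum_mobius k {..<m} (pull \<phi> E)" for \<phi> :: "nat \<Rightarrow> 'a"
  have V: "finite V" "irrefl E" "card V = n" "V \<noteq> {}"
    using pair_graph_parcs[OF G] ne by (auto simp: V_def E_def n_def num_verts_def)
  have B: "B \<ge> 0" by (simp add: B_def mobius_bound_def)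
  have finH: "finite H" unfolding H_def using V by (intro finite_PiE) auto
  have cB: "norm (c \<phi>) \<le> B" for \<phi>
    unfolding c_def B_def using V by (intro norm_psum_mobius_le_bound irrefl_pull) (auto simp: m_def)
  define small where "small = (\<Sum>S | S \<subseteq> V \<and> card S \<le> k. psum_mobius k S E)"
  define top where "top = (\<Sum>S | S \<subseteq> V \<and> card S = m. psum_mobius k S E)"
  define inj where "inj = {\<phi>\<in>H. inj_on \<phi> {..<m}}"
  have "psum k V E = small + top"
  proof -
    have "{S. S \<subseteq> V \<and> card S \<le> Suc k} = {S. S \<subseteq> V \<and> card S \<le> k} \<union> {S. S \<subseteq> V \<and> card S = m}"
      by (auto simp: m_def)
    then show ?thesis
      unfolding psum_eq_sum_mobius[OF V(1,2) k] small_def top_def using V(1)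
      by (simp only:) (rule sum.union_disjoint; auto simp: m_def)
  qed
  moreover have "norm small \<le> B * (real (Suc k) * real n ^ k)"
  proof -
    have "norm small \<le> (\<Sum>S | S \<subseteq> V \<and> card S \<le> k. B)"
      unfolding small_def B_def using V
      by (intro sum_norm_le norm_psum_mobius_le_bound) (auto intro: finite_subset)
    also have "\<dots> = B * real (card {S. S \<subseteq> V \<and> card S \<le> k})" by simp
    also have "\<dots> \<le> B * real (Suc k * n ^ k)"
      using card_small_subsets_le[OF V(1,4), of k] V(3) B by (intro mult_left_mono) (simp_all only: of_nat_le_iff)
    finally show ?thesis by (simp only: of_nat_mult of_nat_power)
  qed
  moreover have "fact m * top = (\<Sum>\<phi>\<in>H. c \<phi>) - (\<Sum>\<phi>\<in>H - inj. c \<phi>)"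
  proof -
    have "fact m * top = (\<Sum>\<phi>\<in>inj. psum_mobius k (\<phi> ` {..<m}) E)"
      unfolding top_def inj_def H_def
      by (subst sum_subsets_eq_sum_injections[OF V(1), symmetric]) simp
    also have "\<dots> = (\<Sum>\<phi>\<in>inj. c \<phi>)"
      unfolding c_def inj_def using V(2) by (intro sum.cong refl psum_mobius_image) auto
    also have "\<dots> = (\<Sum>\<phi>\<in>H. c \<phi>) - (\<Sum>\<phi>\<in>H - inj. c \<phi>)"
      using finH by (simp add: sum_diff inj_def)
    finally show ?thesis .
  qed
  moreover have "norm (\<Sum>\<phi>\<in>H - inj. c \<phi>) \<le> B * real (noninj_count m n)"
  proof -
    have "card inj = (\<Prod>i<m. n - i)"
      unfolding inj_def H_def using card_inj_on_subset_funcset[of "{..<m}" V "{..<m}"] V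
      by (simp add: atLeast0LessThan)
    moreover have "card H = n ^ m" unfolding H_def using V by (simp add: card_funcsetE)
    ultimately have "card (H - inj) = noninj_count m n"
      unfolding noninj_count_def using finH
      by (subst card_Diff_subset) (auto simp: inj_def)
    then show ?thesis using sum_norm_le[of "H - inj" c "\<lambda>_. B"] cB by (simp add: mult.commute)
  qed
  moreover have "(\<Sum>\<phi>\<in>H. c \<phi>) =
      (\<Sum>F\<in>Pow (upper_arcs m). hom_coeff k m F * of_nat (hom_count (test_graph m F) G))"
    unfolding H_def c_def V_def E_def by (rule sum_psum_mobius_eq_homs[OF G])
  ultimately have "psum k V E - (\<Sum>F\<in>Pow (upper_arcs m). hom_coeff k m F * of_nat (hom_count (test_graph m F) G)) / fact m
      = small - (\<Sum>\<phi>\<in>H - inj. c \<phi>) / fact m"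
    and *: "norm small \<le> B * (real (Suc k) * real n ^ k)" "norm (\<Sum>\<phi>\<in>H - inj. c \<phi>) \<le> B * real (noninj_count m n)"
    by (auto simp: field_simps)
  moreover have "norm (small - (\<Sum>\<phi>\<in>H - inj. c \<phi>) / fact m) \<le>
      B * (real (Suc k) * real n ^ k) + B * real (noninj_count m n)"
  proof -
    have "norm ((\<Sum>\<phi>\<in>H - inj. c \<phi>) / fact m) = norm (\<Sum>\<phi>\<in>H - inj. c \<phi>) / fact m"
      by (simp add: norm_divide)
    also have "\<dots> \<le> norm (\<Sum>\<phi>\<in>H - inj. c \<phi>)"
      using fact_ge_1[of m, where 'a=real] by (simp add: divide_le_eq mult_le_cancel_left1)
    finally show ?thesis using * norm_triangle_ineq4[of small] by (meson add_mono order.trans)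
  qed
  ultimately show ?thesis unfolding V_def E_def m_def B_def by (simp add: distrib_left)
qed

text \<open>For \<open>k > 0\<close> the main term is a fixed linear combination of homomorphism
  densities, and both errors vanish after division by the power \<open>Suc k\<close> of the number
  of vertices, which tends to infinity.\<close>

lemma psum_density_convergent:
  fixes G :: "nat \<Rightarrow> 'a pair_pre_digraph"
  assumes G: "\<And>j. pair_graph (G j)" and lim: "filterlim (\<lambda>j. num_verts (G j)) at_top sequentially"
    and dense: "dense_convergent G"
  shows "convergent (\<lambda>j. psum k (pverts (G j)) (parcs (G j)) / of_nat (num_verts (G j)) ^ Suc k)"
proof (cases "k = 0")
  case True
  have "psum 0 (pverts (G j)) (parcs (G j)) = of_nat (num_verts (G j))" for j
    using pair_graph_parcs[OF G[of j]]
    by (simp add: psum_def size_proots_complex degree_cpoly num_verts_def flip: size_eq_sum_mset)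
  moreover have "\<forall>\<^sub>F j in sequentially. of_nat (num_verts (G j)) / of_nat (num_verts (G j)) = (1 :: complex)"
    using lim[unfolded filterlim_at_top, rule_format, of 1] by eventually_elim simp
  ultimately have "(\<lambda>j. psum k (pverts (G j)) (parcs (G j)) / of_nat (num_verts (G j)) ^ Suc k) \<longlonglongrightarrow> 1"
    unfolding True by (intro tendsto_eventually) simp
  then show ?thesis by (rule convergentI)
next
  case False
  define m where "m = Suc k"
  define N where "N j = num_verts (G j)" for j
  define Q where "Q j = (\<Sum>F\<in>Pow (upper_arcs m). hom_coeff k m F * of_nat (hom_count (test_graph m F) (G j))) / fact m" for j
  have "convergent (\<lambda>j. Q j / of_nat (N j) ^ m)"
  proof -
    have "convergent (\<lambda>j. of_real (real (hom_count (test_graph m F) (G j)) / real (N j) ^ m) :: complex)"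
      if F: "F \<in> Pow (upper_arcs m)" for F
    proof -
      \<comment> \<open>Every test graph has exactly \<open>m\<close> vertices, so its density is
        normalised by the required power.\<close>
      have "convergent (\<lambda>j. real (hom_count (test_graph m F) (G j)) / real (N j) ^ num_verts (test_graph m F))"
        using dense pair_graph_test_graph[of F m] F unfolding dense_convergent_def N_def by blast
      then show ?thesis by (intro convergent_of_real) (simp add: num_verts_def test_graph_def)
    qed
    then have "convergent (\<lambda>j. (\<Sum>F\<in>Pow (upper_arcs m). hom_coeff k m F *
        of_real (real (hom_count (test_graph m F) (G j)) / real (N j) ^ m)) * (1 / fact m))"
      by (intro convergent_mult convergent_sum convergent_const)
    then show ?thesis
      by (simp add: Q_def sum_divide_distrib mult.commute)
  qed
  moreover have "(\<lambda>j. psum k (pverts (G j)) (parcs (G j)) / of_nat (N j) ^ m - Q j / of_nat (N j) ^ m) \<longlonglongrightarrow> 0"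
  proof (rule Lim_null_comparison)
    have "\<forall>\<^sub>F j in sequentially. N j > 0"
      using lim[unfolded filterlim_at_top, rule_format, of 1] by (simp add: N_def Suc_le_eq)
    then show "\<forall>\<^sub>F j in sequentially. norm (psum k (pverts (G j)) (parcs (G j)) / of_nat (N j) ^ m - Q j / of_nat (N j) ^ m)
      \<le> mobius_bound k * (real m * (1 / real (N j)) + real (noninj_count m (N j)) / real (N j) ^ m)"
    proof eventually_elim
      case (elim j)
      have "norm (psum k (pverts (G j)) (parcs (G j)) / of_nat (N j) ^ m - Q j / of_nat (N j) ^ m) =
        norm (psum k (pverts (G j)) (parcs (G j)) - Q j) / real (N j) ^ m"
        by (simp add: norm_divide norm_power flip: diff_divide_distrib)
      also have "\<dots> \<le> mobius_bound k * (real m * real (N j) ^ k + real (noninj_count m (N j))) / real (N j) ^ m"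
        unfolding Q_def m_def N_def using psum_hom_estimate[OF G[of j], of k] False elim
        by (intro divide_right_mono) (auto simp: N_def)
      also have "\<dots> = mobius_bound k * (real m * (1 / real (N j)) + real (noninj_count m (N j)) / real (N j) ^ m)"
        using elim by (simp add: m_def field_simps)
      finally show ?case .
    qed
    have "((\<lambda>n. mobius_bound k * (real m * (1 / real n) + real (noninj_count m n) / real n ^ m)) \<longlongrightarrow>
       mobius_bound k * (real m * 0 + 0)) at_top"
      by (intro tendsto_intros noninj_count_tendsto lim_1_over_n)
    then have "((\<lambda>n. mobius_bound k * (real m * (1 / real n) + real (noninj_count m n) / real n ^ m)) \<longlongrightarrow> 0) at_top"
      by simp
    from filterlim_compose[OF this lim]
    show "(\<lambda>j. mobius_bound k * (real m * (1 / real (N j)) + real (noninj_count m (N j)) / real (N j) ^ m)) \<longlonglongrightarrow> 0"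
      by (simp add: N_def)
  qed
  ultimately show ?thesis
    unfolding m_def[symmetric] N_def[symmetric] convergent_def by (auto dest: Lim_transform)
qed

section \<open>Integration of holomorphic functions\<close>

lemma sum_mset_eq_sum_count:
  fixes g :: "'a \<Rightarrow> 'b :: comm_semiring_1"
  shows "(\<Sum>x\<in>#M. g x) = (\<Sum>x\<in>set_mset M. of_nat (count M x) * g x)"
proof (induction M)
  case (add x M)
  have "(\<Sum>y\<in>set_mset (add_mset x M). of_nat (count (add_mset x M) y) * g y) =
      (\<Sum>y\<in>set_mset (add_mset x M). of_nat (count M y) * g y + (if y = x then g y else 0))"
    by (intro sum.cong) (auto simp: algebra_simps)
  also have "\<dots> = (\<Sum>y\<in>set_mset (add_mset x M). of_nat (count M y) * g y) + g x"
    by (simp add: sum.distrib)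
  also have "(\<Sum>y\<in>set_mset (add_mset x M). of_nat (count M y) * g y) = (\<Sum>y\<in>set_mset M. of_nat (count M y) * g y)"
    by (intro sum.mono_neutral_right) (auto simp: not_in_iff)
  finally show ?case using add by (simp add: add.commute)
qed simp

lemma integral_rescaled_chromatic_measure:
  assumes G: "pair_graph G" and n: "num_verts G > 0"
  shows "(\<integral>z. f z \<partial>measure_pmf (rescaled_chromatic_measure G)) =
    (\<Sum>z\<in>#proots (cpoly (pverts G) (parcs G)). f (z / of_nat (num_verts G))) / (of_nat (num_verts G) :: complex)"
proof -
  note g = pair_graph_parcs[OF G]
  let ?R = "proots (cpoly (pverts G) (parcs G))"
  have size: "size ?R = num_verts G"
    using g by (simp add: size_proots_complex degree_cpoly num_verts_def)
  then have ne: "?R \<noteq> {#}" using n by auto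
  have "(\<integral>z. f z \<partial>measure_pmf (rescaled_chromatic_measure G)) =
      (\<integral>z. f (z / of_nat (num_verts G)) \<partial>measure_pmf (pmf_of_multiset ?R))"
    using g by (simp add: rescaled_chromatic_measure_def chromatic_measure_def chromatic_poly_eq_cpoly)
  also have "\<dots> = (\<Sum>z\<in>set_mset ?R. pmf (pmf_of_multiset ?R) z *\<^sub>R f (z / of_nat (num_verts G)))"
    using ne by (intro integral_measure_pmf) (auto simp: set_pmf_of_multiset)
  also have "\<dots> = (\<Sum>z\<in>set_mset ?R. of_nat (count ?R z) * f (z / of_nat (num_verts G))) / of_nat (num_verts G)"
    by (simp only: pmf_of_multiset[OF ne] size) (simp add: sum_divide_distrib scaleR_conv_of_real)
  finally show ?thesis by (simp only: sum_mset_eq_sum_count)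
qed

lemma sum_mset_sums:
  fixes a :: "nat \<Rightarrow> complex"
  assumes "\<And>z. z \<in># R \<Longrightarrow> (\<lambda>k. a k * g z ^ k) sums f z"
  shows "(\<lambda>k. a k * (\<Sum>z\<in>#R. g z ^ k)) sums (\<Sum>z\<in>#R. f z)"
  using assms by (induction R) (auto simp: distrib_left intro: sums_add)

theorem theorem1p3:
  fixes G :: "nat \<Rightarrow> 'a pair_pre_digraph" and f :: "complex \<Rightarrow> complex"
  assumes "\<And>n. pair_graph (G n)"
    and "filterlim (\<lambda>n. num_verts (G n)) at_top sequentially"
    and "dense_convergent G"
    and "f holomorphic_on ball 0 8"
  shows "convergent (\<lambda>n. \<integral>z. f z \<partial>measure_pmf (rescaled_chromatic_measure (G n)))"
proof -
  define N where "N j = num_verts (G j)" for j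
  \<comment> \<open>For \<open>N j > 0\<close> this is the \<open>k\<close>-th moment of the
    rescaled measure: one factor \<open>N j\<close> normalises the mass, the others rescale the
    roots.\<close>
  define p where "p k j = psum k (pverts (G j)) (parcs (G j)) / of_nat (N j) ^ Suc k" for k j
  define a where "a k = (deriv ^^ k) f 0 / fact k" for k
  have taylor: "(\<lambda>k. a k * w ^ k) sums f w" if "norm w < 8" for w
    using holomorphic_power_series[OF assms(4), of w] that by (simp add: a_def)
  have pos: "\<forall>\<^sub>F j in sequentially. N j > 0"
    using assms(2)[unfolded filterlim_at_top, rule_format, of 1] by (simp add: N_def Suc_le_eq)
  \<comment> \<open>The measure has finite support inside the disk, so the Taylor series may be
    integrated term by term.\<close>
  have int: "(\<Sum>k. a k * p k j) = (\<integral>z. f z \<partial>measure_pmf (rescaled_chromatic_measure (G j)))" if "N j > 0" for j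
  proof -
    note g = pair_graph_parcs[OF assms(1)[of j]]
    let ?R = "proots (cpoly (pverts (G j)) (parcs (G j)))"
    have small: "norm (z / of_nat (N j)) < 8" if "z \<in># ?R" for z
    proof -
      have "norm z \<le> 6 * real (N j)"
        using cpoly_root_bound[OF g(1,2), of z] that cpoly_nonzero[OF g(1,2)]
        by (simp add: N_def num_verts_def)
      then have "norm (z / of_nat (N j)) \<le> 6" using \<open>N j > 0\<close> by (simp add: norm_divide divide_le_eq)
      then show ?thesis by linarith
    qed
    have "(\<lambda>k. a k * (\<Sum>z\<in>#?R. (z / of_nat (N j)) ^ k)) sums (\<Sum>z\<in>#?R. f (z / of_nat (N j)))"
      by (rule sum_mset_sums) (rule taylor[OF small])
    moreover have "(\<Sum>z\<in>#R. (z / c) ^ k) = (\<Sum>z\<in>#R. z ^ k) / c ^ k" for R :: "complex multiset" and c k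
      by (induction R) (simp_all add: power_divide add_divide_distrib)
    then have "(\<Sum>z\<in>#?R. (z / of_nat (N j)) ^ k) = p k j * of_nat (N j)" for k
      using that by (simp add: p_def psum_def)
    ultimately have "(\<lambda>k. a k * (p k j * of_nat (N j)) / of_nat (N j)) sums ((\<Sum>z\<in>#?R. f (z / of_nat (N j))) / of_nat (N j))"
      by (intro sums_divide) simp
    then show ?thesis
      using that integral_rescaled_chromatic_measure[OF assms(1), of j f]
      by (simp add: N_def sums_unique[symmetric])
  qed
  have "\<forall>k. \<exists>b. (\<lambda>j. p k j) \<longlonglongrightarrow> b"
    using psum_density_convergent[OF assms(1-3)] unfolding p_def N_def convergent_def by blast
  then obtain b where b: "\<And>k. (\<lambda>j. p k j) \<longlonglongrightarrow> b k" by metis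
  \<comment> \<open>The Taylor series converges at 7, hence absolutely at 6, the bound for the
    rescaled roots.\<close>
  have "summable (\<lambda>k. norm (a k * 6 ^ k))"
    using powser_insidea[of a 7 6] taylor[of 7] by (simp add: sums_iff)
  then have "(\<lambda>j. \<Sum>k. a k * p k j) \<longlonglongrightarrow> (\<Sum>k. a k * b k)"
  proof (intro tannerys_theorem[where M = "\<lambda>k. norm (a k * 6 ^ k)", THEN conjunct2, THEN conjunct2])
    show "(\<lambda>j. a k * p k j) \<longlonglongrightarrow> a k * b k" for k by (intro tendsto_intros b)
    \<comment> \<open>The root bound yields a majorant independent of \<open>j\<close>.\<close>
    have "norm (a k * p k j) \<le> norm (a k * 6 ^ k)" if "N j > 0" for k j
    proof -
      note g = pair_graph_parcs[OF assms(1)[of j]]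
      have "norm (psum k (pverts (G j)) (parcs (G j))) \<le> real (N j) * (6 * real (N j)) ^ k"
        using norm_psum_le[OF g(1,2)] by (simp add: N_def num_verts_def)
      then have "norm (p k j) \<le> 6 ^ k"
        using that by (simp add: p_def norm_divide norm_power norm_mult divide_le_eq power_mult_distrib mult_ac)
      then show ?thesis by (simp add: norm_mult norm_power mult_left_mono)
    qed
    then show "\<forall>\<^sub>F (k, j) in at_top \<times>\<^sub>F sequentially. norm (a k * p k j) \<le> norm (a k * 6 ^ k)"
      using pos unfolding eventually_prod_filter
      by (intro exI[of _ "\<lambda>_. True"] exI[of _ "\<lambda>j. N j > 0"]) auto
  qed auto
  moreover have "\<forall>\<^sub>F j in sequentially. (\<Sum>k. a k * p k j) = (\<integral>z. f z \<partial>measure_pmf (rescaled_chromatic_measure (G j)))"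
    using pos by eventually_elim (rule int)
  ultimately show ?thesis
    by (intro convergentI) (rule Lim_transform_eventually)
qed

end
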